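(* For every $k,D \in \mathbb{N}$ and every $\delta>0$ there exist $\eta, \alpha, C > 0$ such that the following holds for every $\eta$-uniform graph $G$ with $n$ vertices and $m \ge C n$ edges: every $k$-edge-coloring of $G$ contains a monochromatic copy of every graph $H^\sigma$, where $H$ is a graph with maximum degree at most $D$, $\sigma\colon E(H)\to\mathbb{N}$ satisfies $\sigma(e) \ge \delta \log n$ for every $e \in E(H)$, and $v(H^\sigma) \le \alpha n$.
   Context: Given $0<\eta\le 1$, a graph $G$ with $n$ vertices and density $p=e(G)/\binom{n}{2}$ is $\eta$-uniform if for every pair of disjoint subsets $U,W\subseteq V(G)$ with $|U|,|W|\ge \eta n$ we have $\big|e(U,W)-|U||W|p\big|\le \eta|U||W|p$, where $e(U,W)$ is the number of edges with one endpoint in $U$ and the other in $W$. Given a graph $H$ and $\sigma\colon E(H)\to\mathbb{N}$, the $\sigma$-subdivision $H^\sigma$ is obtained from $H$ by replacing each edge $e$ by a path of length $\sigma(e)$ joining the endpoints of $e$, these paths being internally vertex-disjoint from each other and from $V(H)$. $v(\cdot)$ denotes the number of vertices, and $\log$ is the natural logarithm. *)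

theory Defs
  imports Complex_Main
begin

text \<open>A graph is a pair of a vertex set and a set of two-element subsets of it.\<close>

type_synonym 'a ugraph = "'a set \<times> 'a set set"

abbreviation verts :: "'a ugraph \<Rightarrow> 'a set" where "verts \<equiv> fst"

abbreviation edges :: "'a ugraph \<Rightarrow> 'a set set" where "edges \<equiv> snd"

definition finite_graph :: "'a ugraph \<Rightarrow> bool" where
  "finite_graph G \<longleftrightarrow> finite (verts G) \<and> (\<forall>e\<in>edges G. e \<subseteq> verts G \<and> card e = 2)"

definition nv :: "'a ugraph \<Rightarrow> nat" where
  "nv G = card (verts G)"

definition ne :: "'a ugraph \<Rightarrow> nat" where
  "ne G = card (edges G)"

definition vertex_degree :: "'a ugraph \<Rightarrow> 'a \<Rightarrow> nat" where
  "vertex_degree G v = card {e \<in> edges G. v \<in> e}"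

definition max_degree_le :: "'a ugraph \<Rightarrow> nat \<Rightarrow> bool" where
  "max_degree_le G D \<longleftrightarrow> (\<forall>v\<in>verts G. vertex_degree G v \<le> D)"

definition edge_density :: "'a ugraph \<Rightarrow> real" where
  "edge_density G = real (ne G) / real (nv G choose 2)"

definition edges_between :: "'a ugraph \<Rightarrow> 'a set \<Rightarrow> 'a set \<Rightarrow> nat" where
  "edges_between G U W = card {e \<in> edges G. \<exists>u\<in>U. \<exists>w\<in>W. e = {u, w}}"

definition uniform_graph :: "real \<Rightarrow> 'a ugraph \<Rightarrow> bool" where
  "uniform_graph \<eta> G \<longleftrightarrow>
    (\<forall>U W. U \<subseteq> verts G \<longrightarrow> W \<subseteq> verts G \<longrightarrow> U \<inter> W = {} \<longrightarrow>
       real (card U) \<ge> \<eta> * real (nv G) \<longrightarrow> real (card W) \<ge> \<eta> * real (nv G) \<longrightarrow>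
       \<bar>real (edges_between G U W) - real (card U) * real (card W) * edge_density G\<bar>
         \<le> \<eta> * real (card U) * real (card W) * edge_density G)"

text \<open>
  The path replacing the edge \<open>e\<close> visits \<open>subdiv_vertex \<sigma> e 0, \<dots>, subdiv_vertex \<sigma> e (\<sigma> e)\<close>.
  Its two ends are the endpoints of \<open>e\<close>, and its inner vertices \<open>Inr (e, i)\<close> with
  \<open>0 < i < \<sigma> e\<close> are new and belong to \<open>e\<close> only. The linear order on the vertices serves only to
  choose the end at which the path starts. All lengths are meant to be positive.
\<close>

definition subdiv_vertex ::
    "('a::linorder set \<Rightarrow> nat) \<Rightarrow> 'a set \<Rightarrow> nat \<Rightarrow> 'a + ('a set \<times> nat)" where
  "subdiv_vertex \<sigma> e i =
    (if i = 0 then Inl (Min e) else if i = \<sigma> e then Inl (Max e) else Inr (e, i))"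

definition subdivision ::
    "'a::linorder ugraph \<Rightarrow> ('a set \<Rightarrow> nat) \<Rightarrow> ('a + ('a set \<times> nat)) ugraph" where
  "subdivision H \<sigma> =
    (Inl ` verts H \<union> {Inr (e, i) | e i. e \<in> edges H \<and> 0 < i \<and> i < \<sigma> e},
     {{subdiv_vertex \<sigma> e i, subdiv_vertex \<sigma> e (Suc i)} | e i. e \<in> edges H \<and> i < \<sigma> e})"

definition edge_coloring :: "nat \<Rightarrow> 'a ugraph \<Rightarrow> ('a set \<Rightarrow> nat) \<Rightarrow> bool" where
  "edge_coloring k G c \<longleftrightarrow> (\<forall>e\<in>edges G. c e < k)"

text \<open>A copy is a subgraph that need not be induced.\<close>

definition has_monochromatic_copy ::
    "'a ugraph \<Rightarrow> ('a set \<Rightarrow> nat) \<Rightarrow> 'b ugraph \<Rightarrow> bool" where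
  "has_monochromatic_copy G c F \<longleftrightarrow>
    (\<exists>f i. inj_on f (verts F) \<and> f ` verts F \<subseteq> verts G \<and>
       (\<forall>e\<in>edges F. f ` e \<in> edges G \<and> c (f ` e) = i))"

lemma finite_graph_subdivision:
  fixes H :: "'a::linorder ugraph"
  assumes H: "finite_graph H" and pos: "\<And>e. e \<in> edges H \<Longrightarrow> \<sigma> e \<ge> 1"
  shows "finite_graph (subdivision H \<sigma>)"
    and "nv (subdivision H \<sigma>) = nv H + (\<Sum>e\<in>edges H. \<sigma> e - 1)"
proof -
  have finV: "finite (verts H)" and sub: "edges H \<subseteq> Pow (verts H)"
    and c2: "\<And>e. e \<in> edges H \<Longrightarrow> card e = 2"
    using H by (auto simp: finite_graph_def)
  have finE: "finite (edges H)"
    using finV sub by (meson finite_Pow_iff finite_subset)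
  have inner: "{Inr (e, i) | e i. e \<in> edges H \<and> 0 < i \<and> i < \<sigma> e}
      = (Inr ` (SIGMA e:edges H. {0<..<\<sigma> e}) :: ('a + 'a set \<times> nat) set)"
    by auto
  have fin_inner: "finite (SIGMA e:edges H. {0<..<\<sigma> e})"
    using finE by auto
  have ends: "Min e \<in> e \<and> Max e \<in> e \<and> Min e \<noteq> Max e \<and> e \<subseteq> verts H" if e: "e \<in> edges H" for e
  proof -
    obtain x y where "e = {x, y}" "x \<noteq> y"
      using c2[OF e] by (auto simp: card_2_iff)
    then show ?thesis using sub e by (auto simp: min_def max_def)
  qed
  have mem: "subdiv_vertex \<sigma> e i \<in> verts (subdivision H \<sigma>)" if "e \<in> edges H" "i \<le> \<sigma> e" for e i
    using that ends[OF that(1)] by (auto simp: subdiv_vertex_def subdivision_def)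
  have neq: "subdiv_vertex \<sigma> e i \<noteq> subdiv_vertex \<sigma> e (Suc i)" if "e \<in> edges H" for e i
    using ends[OF that] by (auto simp: subdiv_vertex_def)
  have "\<forall>d\<in>edges (subdivision H \<sigma>). d \<subseteq> verts (subdivision H \<sigma>) \<and> card d = 2"
  proof
    fix d assume "d \<in> edges (subdivision H \<sigma>)"
    then obtain e i where "e \<in> edges H" "i < \<sigma> e"
      "d = {subdiv_vertex \<sigma> e i, subdiv_vertex \<sigma> e (Suc i)}"
      by (auto simp: subdivision_def)
    then show "d \<subseteq> verts (subdivision H \<sigma>) \<and> card d = 2"
      using mem[of e i] mem[of e "Suc i"] neq[of e i] by simp
  qed
  moreover have "finite (verts (subdivision H \<sigma>))"
    using finV fin_inner by (simp add: subdivision_def inner)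
  ultimately show "finite_graph (subdivision H \<sigma>)"
    by (simp add: finite_graph_def)
  have "nv (subdivision H \<sigma>) = card (Inl ` verts H :: ('a + 'a set \<times> nat) set)
      + card (Inr ` (SIGMA e:edges H. {0<..<\<sigma> e}) :: ('a + 'a set \<times> nat) set)"
    unfolding nv_def subdivision_def fst_conv inner
    using finV fin_inner by (intro card_Un_disjoint) auto
  also have "\<dots> = nv H + (\<Sum>e\<in>edges H. \<sigma> e - 1)"
    using finE by (simp add: card_image nv_def)
  finally show "nv (subdivision H \<sigma>) = nv H + (\<Sum>e\<in>edges H. \<sigma> e - 1)" .
qed

end

theory Submission
  imports Defs "HOL-Library.Ramsey"
begin

text \<open>
  Only one consequence of uniformity is used: any two disjoint vertex sets of linear size are joined
  by an edge. Split the vertices into many equal parts. For each pair of parts and each colour in turn,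
  either all large subsets of the two parts are joined in that colour, or passing to a subpair
  eliminates the colour. Hence after shrinking every pair of parts is ``full'' in some colour, and
  Ramsey's theorem for triangles gives three parts \<open>A 0\<close>, \<open>A 1\<close>, \<open>A 2\<close> which are pairwise full
  in one colour. Three parts rather than two are needed to realise paths of either parity.

  In this tripartite graph the subdivision is embedded by the tree embedding method of Friedman and
  Pippenger with rollback. A slot is a request of a vertex for a child in a prescribed part, and an
  embedding is a matching of slots to vertices. One keeps the invariant that small sets of
  unmatched slots satisfy Hall's condition with respect to the unmatched vertices. A matching with
  the invariant can be extended at any slot, and every subset of it again has the invariant. To join two
  embedded branch vertices by a path of length \<open>\<sigma> e\<close>, grow from each a path ending in
  a \<open>d\<close>-ary tree of logarithmic depth, find an edge between the two large sets of leaves, and forget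
  everything except the path.
\<close>

section \<open>Matchings with a local Hall condition\<close>

definition small_hall :: "nat \<Rightarrow> ('l \<Rightarrow> 'v set) \<Rightarrow> 'l set \<Rightarrow> 'v set \<Rightarrow> bool" where
  "small_hall k N L V \<longleftrightarrow> (\<forall>X\<subseteq>L. card X \<le> k \<longrightarrow> card X \<le> card (\<Union>(N ` X) \<inter> V))"

text \<open>
  If every choice of \<open>y\<close> failed, then \<open>N x\<close> would be covered by neighbourhoods of tight sets. By
  submodularity the union of these sets is tight, and adding \<open>x\<close> to it violates Hall's condition.
\<close>

lemma small_hall_step:
  assumes finL: "finite L" and finV: "finite V"
    and hall: "small_hall (2 * m) N L V"
    and strict: "\<And>X. X \<subseteq> L \<Longrightarrow> m \<le> card X \<Longrightarrow> card X \<le> 2 * m \<Longrightarrow> card X < card (\<Union>(N ` X) \<inter> V)"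
    and x: "x \<in> L"
  shows "\<exists>y\<in>N x \<inter> V. small_hall (2 * m) N (L - {x}) (V - {y})"
proof (rule ccontr)
  assume contra: "\<not> ?thesis"
  define tight where
    "tight X \<longleftrightarrow> X \<subseteq> L - {x} \<and> card X \<le> 2 * m \<and> card (\<Union>(N ` X) \<inter> V) \<le> card X" for X
  \<comment> \<open>Sizes between \<open>m\<close> and \<open>2 * m\<close> have a strict surplus,
    so tight sets stay below \<open>m\<close>; this gap keeps the union of two tight sets within the
    range \<open>2 * m\<close> of the hypothesis.\<close>
  have tight_small: "card X < m" if "tight X" for X
    using strict[of X] that unfolding tight_def by (meson Diff_subset leD le_less_linear order_trans)
  have tight_Un: "tight (X \<union> Y)" if X: "tight X" and Y: "tight Y" for X Y
  proof -
    have fin: "finite X" "finite Y"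
      using X Y finL unfolding tight_def by (meson finite_Diff finite_subset)+
    have le: "card (X \<union> Y) + card (X \<inter> Y) = card X + card Y"
      using card_Un_Int[OF fin] by simp
    let ?n = "\<lambda>X. \<Union>(N ` X) \<inter> V"
    have "card (?n (X \<union> Y)) + card (?n (X \<inter> Y)) \<le> card (?n X \<union> ?n Y) + card (?n X \<inter> ?n Y)"
      using finV by (intro add_mono card_mono) auto
    also have "\<dots> = card (?n X) + card (?n Y)"
      using card_Un_Int[of "?n X" "?n Y"] finV by simp
    also have "\<dots> \<le> card (X \<union> Y) + card (X \<inter> Y)"
      using X Y le unfolding tight_def by linarith
    finally have 1: "card (?n (X \<union> Y)) + card (?n (X \<inter> Y)) \<le> card (X \<union> Y) + card (X \<inter> Y)" .
    have "card (X \<inter> Y) \<le> card X"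
      using fin by (simp add: card_mono)
    moreover have "X \<inter> Y \<subseteq> L" "card X \<le> 2 * m"
      using X unfolding tight_def by auto
    ultimately have "card (X \<inter> Y) \<le> card (?n (X \<inter> Y))"
      using hall unfolding small_hall_def by (meson order_trans)
    with 1 have "card (?n (X \<union> Y)) \<le> card (X \<union> Y)"
      by linarith
    moreover have "card (X \<union> Y) \<le> 2 * m"
      using tight_small[OF X] tight_small[OF Y] le by linarith
    ultimately show ?thesis
      using X Y unfolding tight_def by blast
  qed
  have "\<exists>X. tight X \<and> y \<in> \<Union>(N ` X)" if y: "y \<in> N x \<inter> V" for y
  proof -
    obtain X where X: "X \<subseteq> L - {x}" "card X \<le> 2 * m"
      and lt: "card (\<Union>(N ` X) \<inter> (V - {y})) < card X"
      using contra y unfolding small_hall_def by (meson not_le)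
    have ge: "card X \<le> card (\<Union>(N ` X) \<inter> V)"
      using hall X unfolding small_hall_def by (meson Diff_subset order_trans)
    have eq: "\<Union>(N ` X) \<inter> (V - {y}) = (\<Union>(N ` X) \<inter> V) - {y}"
      by auto
    have "y \<in> \<Union>(N ` X)"
    proof (rule ccontr)
      assume "y \<notin> \<Union>(N ` X)"
      then have "\<Union>(N ` X) \<inter> (V - {y}) = \<Union>(N ` X) \<inter> V" by auto
      with lt ge show False by simp
    qed
    then have "card (\<Union>(N ` X) \<inter> V - {y}) = card (\<Union>(N ` X) \<inter> V) - 1"
      using y by (intro card_Diff_singleton) blast
    then have "card (\<Union>(N ` X) \<inter> V) \<le> card X"
      using lt unfolding eq by linarith
    with \<open>y \<in> \<Union>(N ` X)\<close> show ?thesis using X unfolding tight_def by blast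
  qed
  then obtain F where F: "\<And>y. y \<in> N x \<inter> V \<Longrightarrow> tight (F y) \<and> y \<in> \<Union>(N ` F y)"
    by metis
  have "tight (\<Union>(F ` B))" if "finite B" "B \<subseteq> N x \<inter> V" for B
    using that
  proof (induction B rule: finite_induct)
    case empty
    then show ?case by (simp add: tight_def)
  next
    case (insert b B)
    then show ?case using F tight_Un by auto
  qed
  from this[of "N x \<inter> V"] have Z: "tight (\<Union>(F ` (N x \<inter> V)))" (is "tight ?Z")
    using finV by simp
  have cover: "N x \<inter> V \<subseteq> \<Union>(N ` ?Z)"
    using F by fastforce
  have finZ: "finite ?Z" and xZ: "x \<notin> ?Z" and ZL: "?Z \<subseteq> L"
    using Z finL unfolding tight_def by (auto intro: finite_subset)
  have "card (insert x ?Z) \<le> card (\<Union>(N ` insert x ?Z) \<inter> V)"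
  proof -
    have "insert x ?Z \<subseteq> L" "card (insert x ?Z) \<le> 2 * m"
      using x ZL tight_small[OF Z] finZ xZ by simp_all
    then show ?thesis using hall unfolding small_hall_def by blast
  qed
  also have "\<Union>(N ` insert x ?Z) \<inter> V = \<Union>(N ` ?Z) \<inter> V"
    using cover by auto
  also have "card \<dots> \<le> card ?Z"
    using Z unfolding tight_def by auto
  finally show False using finZ xZ by simp
qed

text \<open>\<open>K\<close> bounds the size of the matchings to which a further edge can be added.\<close>

locale extendable =
  fixes N :: "'l \<Rightarrow> 'v set" and L :: "'l set" and V :: "'v set" and m K :: nat
  assumes finL: "finite L" and finV: "finite V"
    and hall: "small_hall (2 * m) N L V"
    and large: "\<And>X. X \<subseteq> L \<Longrightarrow> m \<le> card X \<Longrightarrow> card X \<le> 2 * m \<Longrightarrow> K + 2 * m < card (\<Union>(N ` X) \<inter> V)"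
begin

text \<open>A matching is a set of pairs, so that adding a vertex is \<open>insert\<close> and
  rollback is passing to a subset.\<close>

definition good :: "('l \<times> 'v) set \<Rightarrow> bool" where
  "good M \<longleftrightarrow> (\<forall>(x, y)\<in>M. x \<in> L \<and> y \<in> V \<and> y \<in> N x) \<and> inj_on fst M \<and> inj_on snd M \<and>
    small_hall (2 * m) N (L - fst ` M) (V - snd ` M)"

lemma good_empty: "good {}"
  using hall by (simp add: good_def)

lemma good_finite: "good M \<Longrightarrow> finite M"
  unfolding good_def using finL finV by (auto intro!: finite_subset[of M "L \<times> V"])

text \<open>Rollback is harmless: a slot set splits into slots free under \<open>M\<close>, which
  satisfy the old Hall condition, and released slots, each of which regains its former partner;
  these partners are distinct from each other and from the vertices free under
  \<open>M\<close>.\<close>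

lemma good_subset:
  assumes M: "good M" and sub: "M' \<subseteq> M"
  shows "good M'"
proof -
  have finM: "finite M" using good_finite[OF M] .
  have "card X \<le> card (\<Union>(N ` X) \<inter> (V - snd ` M'))"
    if X: "X \<subseteq> L - fst ` M'" and cX: "card X \<le> 2 * m" for X
  proof -
    define P where "P = {p \<in> M. fst p \<in> X}"
    have finX: "finite X" using X finL by (meson finite_Diff finite_subset)
    have P1: "fst ` P = X \<inter> fst ` M" by (auto simp: P_def)
    have Psub: "P \<subseteq> M" by (auto simp: P_def)
    have "card (X - fst ` M) \<le> card X"
      using finX by (simp add: card_mono)
    then have "card (X - fst ` M) \<le> card (\<Union>(N ` (X - fst ` M)) \<inter> (V - snd ` M))" (is "_ \<le> card ?B")
      using M X cX unfolding good_def small_hall_def by (meson Diff_mono Diff_subset order_trans subset_refl)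
    moreover have "card (X \<inter> fst ` M) = card (snd ` P)"
      using M Psub P1 unfolding good_def by (metis card_image inj_on_subset)
    moreover have "card X = card (X - fst ` M) + card (X \<inter> fst ` M)"
      using finX by (metis add.commute card_Int_Diff)
    ultimately have "card X \<le> card ?B + card (snd ` P)" by linarith
    also have "\<dots> = card (?B \<union> snd ` P)"
      using finV finM Psub by (intro card_Un_disjoint[symmetric]) (auto intro: finite_subset)
    also have "\<dots> \<le> card (\<Union>(N ` X) \<inter> (V - snd ` M'))"
    proof (rule card_mono)
      show "finite (\<Union>(N ` X) \<inter> (V - snd ` M'))" using finV by simp
      have "snd p \<notin> snd ` M'" if p: "p \<in> P" for p
      proof
        assume "snd p \<in> snd ` M'"
        then obtain q where "q \<in> M'" "snd q = snd p" by auto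
        then have "q = p"
          using M sub p Psub unfolding good_def inj_on_def by blast
        with \<open>q \<in> M'\<close> p X show False by (auto simp: P_def)
      qed
      moreover have "snd p \<in> \<Union>(N ` X) \<inter> V" if "p \<in> P" for p
      proof -
        have "p \<in> M" "fst p \<in> X" using that by (auto simp: P_def)
        moreover have "snd p \<in> V" "snd p \<in> N (fst p)"
          using M \<open>p \<in> M\<close> unfolding good_def by (auto simp: case_prod_beta)
        ultimately show ?thesis by blast
      qed
      ultimately have "snd ` P \<subseteq> \<Union>(N ` X) \<inter> (V - snd ` M')"
        by (intro image_subsetI IntI DiffI) (metis IntE)+
      moreover have "?B \<subseteq> \<Union>(N ` X) \<inter> (V - snd ` M')"
        using sub by blast
      ultimately show "?B \<union> snd ` P \<subseteq> \<Union>(N ` X) \<inter> (V - snd ` M')"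
        by blast
    qed
    finally show ?thesis .
  qed
  then have "small_hall (2 * m) N (L - fst ` M') (V - snd ` M')"
    unfolding small_hall_def by blast
  moreover have "inj_on fst M'" "inj_on snd M'"
    using M sub unfolding good_def by (meson inj_on_subset)+
  ultimately show ?thesis
    using M sub unfolding good_def by blast
qed

text \<open>At most \<open>K\<close> vertices are occupied, so by \<open>large\<close> every set of
  between \<open>m\<close> and \<open>2 * m\<close> free slots still has more than
  \<open>2 * m\<close> free neighbours, which is the surplus that \<open>small_hall_step\<close>
  asks for.\<close>

lemma good_extend:
  assumes M: "good M" and x: "x \<in> L" "x \<notin> fst ` M" and c: "card M \<le> K"
  shows "\<exists>y. y \<in> N x \<and> y \<in> V \<and> y \<notin> snd ` M \<and> good (insert (x, y) M)"
proof -
  have finM: "finite M" using good_finite[OF M] .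
  have "\<exists>y\<in>N x \<inter> (V - snd ` M). small_hall (2 * m) N (L - fst ` M - {x}) (V - snd ` M - {y})"
  proof (rule small_hall_step)
    show "small_hall (2 * m) N (L - fst ` M) (V - snd ` M)"
      using M by (simp add: good_def)
    show "card X < card (\<Union> (N ` X) \<inter> (V - snd ` M))"
      if X: "X \<subseteq> L - fst ` M" "m \<le> card X" "card X \<le> 2 * m" for X
    proof -
      have "K + 2 * m < card (\<Union>(N ` X) \<inter> V)"
        using X by (intro large) auto
      also have "\<dots> \<le> card (\<Union>(N ` X) \<inter> (V - snd ` M) \<union> snd ` M)"
        using finV finM by (intro card_mono) auto
      also have "\<dots> \<le> card (\<Union>(N ` X) \<inter> (V - snd ` M)) + card (snd ` M)"
        by (rule card_Un_le)
      also have "card (snd ` M) \<le> K"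
        using card_image_le[OF finM, of snd] c by linarith
      finally show ?thesis using X by linarith
    qed
  qed (use finL finV x in auto)
  then obtain y where y: "y \<in> N x" "y \<in> V" "y \<notin> snd ` M"
    and h: "small_hall (2 * m) N (L - fst ` M - {x}) (V - snd ` M - {y})" by auto
  have "L - fst ` M - {x} = L - fst ` insert (x, y) M" "V - snd ` M - {y} = V - snd ` insert (x, y) M"
    by auto
  then have "small_hall (2 * m) N (L - fst ` insert (x, y) M) (V - snd ` insert (x, y) M)"
    using h by simp
  moreover have "inj_on fst (insert (x, y) M)" "inj_on snd (insert (x, y) M)"
    using M x y unfolding good_def inj_on_insert by auto
  ultimately have "good (insert (x, y) M)"
    using M x y unfolding good_def by blast
  with y show ?thesis by auto
qed

lemma good_fill:
  assumes M: "good M" and T: "T \<subseteq> L - fst ` M" and c: "card M + card T \<le> K"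
  shows "\<exists>M'. good M' \<and> M \<subseteq> M' \<and> fst ` M' = fst ` M \<union> T"
proof -
  have "finite T" using T finL by (meson finite_Diff finite_subset)
  then show ?thesis using T c
  proof (induction T rule: finite_induct)
    case empty
    then show ?case using M by auto
  next
    case (insert x T)
    then obtain M' where M': "good M'" "M \<subseteq> M'" "fst ` M' = fst ` M \<union> T" by auto
    have "card M' = card (fst ` M')"
      using M'(1) unfolding good_def by (metis card_image)
    also have "\<dots> \<le> card (fst ` M) + card T"
      unfolding M' by (rule card_Un_le)
    also have "card (fst ` M) = card M"
      using M by (simp add: good_def card_image)
    finally have "card M' \<le> K" using insert by simp
    with good_extend[OF M'(1), of x] insert M' obtain y where "good (insert (x, y) M')" by auto
    with M' show ?case by (intro exI[of _ "insert (x, y) M'"]) auto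
  qed
qed

end

section \<open>Tripartite host graphs\<close>

text \<open>The factor \<open>50\<close> is generous: vertices missed by \<open>join\<close>,
  deleted vertices and the neighbourhoods required afterwards never amount to more than
  \<open>37 * (d * m0)\<close>.\<close>

locale host =
  fixes A :: "nat \<Rightarrow> 'v set" and adj :: "'v \<Rightarrow> 'v \<Rightarrow> bool" and m0 d :: nat and U :: "'u set"
  assumes finA: "c < 3 \<Longrightarrow> finite (A c)"
    and disj: "i < 3 \<Longrightarrow> j < 3 \<Longrightarrow> i \<noteq> j \<Longrightarrow> A i \<inter> A j = {}"
    and adj_sym: "adj x y \<Longrightarrow> adj y x"
    and join: "i < 3 \<Longrightarrow> j < 3 \<Longrightarrow> i \<noteq> j \<Longrightarrow> X \<subseteq> A i \<Longrightarrow> Y \<subseteq> A j \<Longrightarrow>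
      m0 \<le> card X \<Longrightarrow> m0 \<le> card Y \<Longrightarrow> \<exists>x\<in>X. \<exists>y\<in>Y. adj x y"
    and size: "c < 3 \<Longrightarrow> 50 * (d * m0) \<le> card (A c)"
    and m0: "1 \<le> m0" and d: "2 \<le> d" and finU: "finite U"
begin

text \<open>
  \<open>Inl (v, c, i)\<close> asks for the \<open>i\<close>-th child of \<open>v\<close> in the part \<open>A c\<close>, and \<open>Inr u\<close> asks for the image of
  the branch vertex \<open>u\<close>.
\<close>

definition nb :: "('v \<times> nat \<times> nat) + 'u \<Rightarrow> 'v set" where
  "nb s = (case s of Inl (v, c, i) \<Rightarrow> {y \<in> A c. adj v y} | Inr u \<Rightarrow> A 0)"

lemma nb_simps [simp]: "nb (Inl (v, c, i)) = {y \<in> A c. adj v y}" "nb (Inr u) = A 0"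
  by (simp_all add: nb_def)

text \<open>A vertex has no slots into its own part, since \<open>join\<close> provides edges only
  between different parts.\<close>

definition slots :: "'v set \<Rightarrow> (('v \<times> nat \<times> nat) + 'u) set" where
  "slots W = {Inl (v, c, i) | v c i. v \<in> W \<and> c < 3 \<and> v \<notin> A c \<and> i < d}"

definition host_verts :: "'v set" where
  "host_verts = (\<Union>c<3. A c)"

lemma finite_host_verts: "finite host_verts"
  using finA by (auto simp: host_verts_def)

lemma A_sub: "c < 3 \<Longrightarrow> A c \<subseteq> host_verts"
  by (auto simp: host_verts_def)

lemma finite_slots:
  assumes "W \<subseteq> host_verts" shows "finite (slots W)"
proof -
  have "slots W \<subseteq> Inl ` (W \<times> {..<3} \<times> {..<d})"
    by (auto simp: slots_def)
  moreover have "finite W"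
    using assms finite_host_verts by (rule finite_subset)
  ultimately show ?thesis by (metis finite_SigmaI finite_imageI finite_lessThan finite_subset)
qed

text \<open>Pigeonhole: the part of the owner, the requested part and the index give
  \<open>9 * d\<close> classes, so some class has at least \<open>m0\<close> slots. Their owners are
  distinct vertices of a single part, and by \<open>join\<close> they miss fewer than
  \<open>m0\<close> vertices of the requested part.\<close>

lemma large_slots:
  assumes X: "X \<subseteq> slots host_verts" and c: "9 * (d * m0) \<le> card X"
  shows "\<exists>c<3. card (A c) < card (\<Union>(nb ` X) \<inter> A c) + m0"
proof -
  let ?I = "{..<3::nat} \<times> {..<3::nat} \<times> {..<d}"
  let ?B = "\<lambda>(j, c, i). {v \<in> A j. Inl (v, c, i) \<in> X}"
  let ?f = "\<lambda>p. (\<lambda>v. Inl (v, snd p)) ` ?B p :: ('v \<times> nat \<times> nat + 'u) set"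
  have "\<exists>p\<in>?I. m0 \<le> card (?B p)"
  proof (rule ccontr)
    assume none: "\<not> ?thesis"
    have lt: "card (?B p) \<le> m0 - 1" if "p \<in> ?I" for p
    proof -
      have "\<not> m0 \<le> card (?B p)"
        using none that by blast
      then show ?thesis by linarith
    qed
    have "X \<subseteq> (\<Union>p\<in>?I. ?f p)"
    proof
      fix s assume s: "s \<in> X"
      then obtain v c i where v: "s = Inl (v, c, i)" "v \<in> host_verts" "c < 3" "i < d"
        using X unfolding slots_def by blast
      then obtain j where "j < 3" "v \<in> A j" by (auto simp: host_verts_def)
      then have "(j, c, i) \<in> ?I" "s \<in> ?f (j, c, i)" using v s by auto
      then show "s \<in> (\<Union>p\<in>?I. ?f p)" by blast
    qed
    moreover have fin: "finite (?B p)" if "p \<in> ?I" for p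
      using that finA by auto
    ultimately have "card X \<le> card (\<Union>p\<in>?I. ?f p)"
      by (intro card_mono finite_UN_I) auto
    also have "\<dots> \<le> (\<Sum>p\<in>?I. card (?f p))"
      by (rule card_UN_le) auto
    also have "\<dots> \<le> (\<Sum>p\<in>?I. m0 - 1)"
      by (intro sum_mono order_trans[OF card_image_le lt] fin)
    also have "\<dots> = 9 * (d * (m0 - 1))"
      by simp
    also have "\<dots> < 9 * (d * m0)"
      using m0 d by simp
    finally show False using c by simp
  qed
  then obtain j c i where j: "j < 3" "c < 3" and B: "m0 \<le> card {v \<in> A j. Inl (v, c, i) \<in> X}" (is "_ \<le> card ?C")
    by auto
  have jc: "j \<noteq> c"
  proof
    assume "j = c"
    then have "?C = {}" using X by (auto simp: slots_def)
    with B m0 show False by (metis card.empty not_one_le_zero order_trans)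
  qed
  let ?D = "A c - \<Union>(nb ` X)"
  have "card ?D < m0"
  proof (rule ccontr)
    assume "\<not> ?thesis"
    then obtain x y where "x \<in> ?C" "y \<in> ?D" "adj x y"
      using join[OF j jc, of ?C ?D] B by auto
    then have "y \<in> nb (Inl (x, c, i))" "Inl (x, c, i) \<in> X" by auto
    then show False using \<open>y \<in> ?D\<close> by blast
  qed
  moreover have "card (A c) = card (A c \<inter> \<Union>(nb ` X)) + card ?D"
    using finA[OF j(2)] by (rule card_Int_Diff)
  ultimately show ?thesis using j by (auto simp: Int_commute)
qed

section \<open>Deleting the owners of slots that violate Hall's condition\<close>

definition slot_vertex :: "('v \<times> nat \<times> nat) + 'u \<Rightarrow> 'v" where
  "slot_vertex s = fst (projl s)"

lemma slot_vertex_Inl [simp]: "slot_vertex (Inl (v, c, i)) = v"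
  by (simp add: slot_vertex_def)

text \<open>
  A maximal set of slots violating Hall's condition has fewer than \<open>9 * (d * m0)\<close> elements, and
  deleting its vertices leaves no violation.
\<close>

lemma exists_small_hall:
  "\<exists>R. finite R \<and> card R \<le> 9 * (d * m0) \<and>
    small_hall (2 * (9 * (d * m0))) nb (slots (host_verts - R)) (host_verts - R)"
proof -
  let ?m = "9 * (d * m0)"
  \<comment> \<open>A bad set is tested against vertices outside its own owners, because these
    owners are what is deleted. The inequality is nonstrict so that the empty set is bad and a
    maximal bad set exists.\<close>
  define bad where "bad Y \<longleftrightarrow> Y \<subseteq> slots host_verts \<and> card Y \<le> 2 * ?m \<and>
    card (\<Union>(nb ` Y) \<inter> (host_verts - slot_vertex ` Y)) \<le> card Y" for Y
  have fin: "finite Y" if "Y \<subseteq> slots host_verts" for Y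
    using that finite_slots[of host_verts] finite_subset by blast
  have "bad {}" by (simp add: bad_def)
  moreover have "\<forall>Y. bad Y \<longrightarrow> card Y < 2 * ?m + 1" by (auto simp: bad_def)
  ultimately obtain Y where Y: "bad Y" and Ymax: "\<And>Z. bad Z \<Longrightarrow> card Z \<le> card Y"
    using ex_has_greatest_nat[of bad "{}" card "2 * ?m + 1"] by (metis less_imp_le)
  let ?R = "slot_vertex ` Y"
  have Ysub: "Y \<subseteq> slots host_verts" using Y by (simp add: bad_def)
  have finY: "finite Y" using fin[OF Ysub] .
  have Rle: "card ?R \<le> card Y" using finY by (rule card_image_le)
  have md: "m0 \<le> d * m0" using d by simp
  \<comment> \<open>Even with the owners of \<open>Y\<close> deleted, \<open>9 * (d * m0)\<close>
    slots see more than \<open>18 * (d * m0)\<close> vertices. So bad and violating sets are both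
    smaller than \<open>9 * (d * m0)\<close>, and their union is small enough to be bad.\<close>
  have large: "2 * ?m < card (\<Union>(nb ` X) \<inter> (host_verts - ?R))"
    if X: "X \<subseteq> slots host_verts" "?m \<le> card X" for X
  proof -
    obtain c where c: "c < 3" "card (A c) < card (\<Union>(nb ` X) \<inter> A c) + m0"
      using large_slots[OF X] by auto
    have "card (\<Union>(nb ` X) \<inter> A c) \<le> card (\<Union>(nb ` X) \<inter> (host_verts - ?R) \<union> ?R)"
      using A_sub[OF c(1)] finite_host_verts finY by (intro card_mono) auto
    also have "\<dots> \<le> card (\<Union>(nb ` X) \<inter> (host_verts - ?R)) + card ?R"
      by (rule card_Un_le)
    finally show ?thesis
      using c(2) size[OF c(1)] Rle Y md m0 unfolding bad_def by linarith
  qed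
  have Ysmall: "card Y < ?m"
    using large[OF Ysub] Y unfolding bad_def by linarith
  have "card X \<le> card (\<Union>(nb ` X) \<inter> (host_verts - ?R))"
    if X: "X \<subseteq> slots (host_verts - ?R)" "card X \<le> 2 * ?m" for X
  proof (rule ccontr)
    assume not: "\<not> ?thesis"
    have Xsub: "X \<subseteq> slots host_verts" using X by (auto simp: slots_def)
    have finX: "finite X" using fin[OF Xsub] .
    have Xsmall: "card X < ?m"
      using large[OF Xsub] not X by linarith
    \<comment> \<open>The owners of \<open>X\<close> avoid \<open>?R\<close>, so \<open>X\<close> is
      disjoint from \<open>Y\<close> and a nonempty \<open>X\<close> would enlarge the maximal bad
      set.\<close>
    have "slot_vertex s \<notin> ?R" if "s \<in> X" for s
      using that X by (auto simp: slots_def)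
    then have "X \<inter> Y = {}" by blast
    then have cU: "card (X \<union> Y) = card X + card Y"
      using finX finY by (simp add: card_Un_disjoint)
    have "card (\<Union>(nb ` (X \<union> Y)) \<inter> (host_verts - slot_vertex ` (X \<union> Y)))
        \<le> card (\<Union>(nb ` X) \<inter> (host_verts - ?R) \<union> \<Union>(nb ` Y) \<inter> (host_verts - ?R))"
      using finite_host_verts by (intro card_mono) auto
    also have "\<dots> \<le> card (\<Union>(nb ` X) \<inter> (host_verts - ?R)) + card (\<Union>(nb ` Y) \<inter> (host_verts - ?R))"
      by (rule card_Un_le)
    also have "\<dots> \<le> card X + card Y"
      using not Y unfolding bad_def by linarith
    finally have "bad (X \<union> Y)"
      using Xsub Ysub cU Xsmall Ysmall unfolding bad_def by simp
    from Ymax[OF this] have "X = {}" using cU finX by simp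
    then show False using not by simp
  qed
  then show ?thesis
    using Rle Ysmall finY unfolding small_hall_def by (intro exI[of _ ?R]) auto
qed

end

text \<open>Fixes the set supplied by \<open>exists_small_hall\<close>, whose vertices are discarded
  both as owners and as targets, so that \<open>extendable\<close> becomes a sublocale.\<close>

locale clean_host = host A adj m0 d U
  for A :: "nat \<Rightarrow> 'v set" and adj :: "'v \<Rightarrow> 'v \<Rightarrow> bool" and m0 d :: nat and U :: "'u set" +
  fixes R :: "'v set"
  assumes finR: "finite R" and cardR: "card R \<le> 9 * (d * m0)"
    and hallR: "small_hall (2 * (9 * (d * m0))) nb (slots (host_verts - R)) (host_verts - R)"
begin

text \<open>A set containing a root slot sees all of \<open>A 0\<close>, which is large enough by
  \<open>size\<close>; the remaining sets consist of child slots and are covered by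
  \<open>hallR\<close> and \<open>large_slots\<close>.\<close>

lemma extendable:
  "extendable nb (slots (host_verts - R) \<union> Inr ` U) (host_verts - R) (9 * (d * m0)) (6 * (d * m0))"
proof
  let ?L = "slots (host_verts - R) \<union> Inr ` U" and ?V = "host_verts - R"
  have md: "m0 \<le> d * m0" using d by simp
  show "finite ?L" using finite_slots[of ?V] finU by simp
  show finV: "finite ?V" using finite_host_verts by simp
  have A_less: "card (\<Union>(nb ` X) \<inter> A c) \<le> card (\<Union>(nb ` X) \<inter> ?V) + 9 * (d * m0)" if "c < 3" for X c
  proof -
    have "card (\<Union>(nb ` X) \<inter> A c) \<le> card (\<Union>(nb ` X) \<inter> ?V \<union> R)"
      using A_sub[OF that] finV finR by (intro card_mono) auto
    also have "\<dots> \<le> card (\<Union>(nb ` X) \<inter> ?V) + card R"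
      by (rule card_Un_le)
    finally show ?thesis using cardR by linarith
  qed
  have root: "6 * (d * m0) + 2 * (9 * (d * m0)) < card (\<Union>(nb ` X) \<inter> ?V)" if "Inr u \<in> X" for X u
  proof -
    have "A 0 \<subseteq> \<Union>(nb ` X)"
      using that nb_simps(2)[of u] by blast
    then have "\<Union>(nb ` X) \<inter> A 0 = A 0" by blast
    then have "card (A 0) \<le> card (\<Union>(nb ` X) \<inter> ?V) + 9 * (d * m0)"
      using A_less[of 0 X] by simp
    moreover have "50 * (d * m0) \<le> card (A 0)"
      by (rule size) simp
    ultimately show ?thesis using md m0 by linarith
  qed
  show "6 * (d * m0) + 2 * (9 * (d * m0)) < card (\<Union>(nb ` X) \<inter> ?V)"
    if X: "X \<subseteq> ?L" "9 * (d * m0) \<le> card X" "card X \<le> 2 * (9 * (d * m0))" for X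
  proof (cases "\<exists>u. Inr u \<in> X")
    case True
    then show ?thesis using root by blast
  next
    case False
    then have "X \<subseteq> slots host_verts" using X(1) by (auto simp: slots_def)
    then obtain c where c: "c < 3" "card (A c) < card (\<Union>(nb ` X) \<inter> A c) + m0"
      using large_slots X(2) by blast
    then show ?thesis using A_less[OF c(1), of X] size[OF c(1)] md by linarith
  qed
  show "small_hall (2 * (9 * (d * m0))) nb ?L ?V"
    unfolding small_hall_def
  proof (intro allI impI)
    fix X assume X: "X \<subseteq> ?L" "card X \<le> 2 * (9 * (d * m0))"
    show "card X \<le> card (\<Union>(nb ` X) \<inter> ?V)"
    proof (cases "\<exists>u. Inr u \<in> X")
      case True
      then show ?thesis using root X(2) by fastforce
    next
      case False
      then have "X \<subseteq> slots ?V" using X(1) by blast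
      then show ?thesis using hallR X(2) unfolding small_hall_def by blast
    qed
  qed
qed

sublocale extendable nb "slots (host_verts - R) \<union> Inr ` U" "host_verts - R" "9 * (d * m0)" "6 * (d * m0)"
  by (rule extendable)

end

section \<open>Growing trees and joining two vertices by a path\<close>

text \<open>Truncated subtraction makes levels \<open>0\<close> to \<open>q\<close> singletons. From
  level \<open>q\<close> on the sum is geometric and at most twice its last term.\<close>

lemma sum_level_sizes:
  fixes d q h :: nat
  assumes "2 \<le> d"
  shows "(\<Sum>j\<le>q + h. d ^ (j - q)) \<le> q + 2 * d ^ h"
proof (induction h)
  case 0
  have "(\<Sum>j\<le>q. d ^ (j - q)) = (\<Sum>j\<le>q. 1)"
    by (intro sum.cong) auto
  then show ?case by simp
next
  case (Suc h)
  have "2 * d ^ h \<le> d ^ Suc h" using mult_right_mono[OF assms, of "d ^ h"] by simp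
  with Suc have "(\<Sum>j\<le>q + h. d ^ (j - q)) + d ^ Suc h \<le> q + 2 * d ^ Suc h" by linarith
  then show ?case by simp
qed

context clean_host
begin

definition fresh :: "((('v \<times> nat \<times> nat) + 'u) \<times> 'v) set \<Rightarrow> 'v set \<Rightarrow> bool" where
  "fresh M Y \<longleftrightarrow> (\<forall>v c i. Inl (v, c, i) \<in> fst ` M \<longrightarrow> v \<in> snd ` M - Y)"

text \<open>\<open>Q\<close> is the piece of a matching that survives rollback when only the path
  \<open>zs\<close> hanging off \<open>s\<close> is kept. The bound on its slots ensures that it
  uses only \<open>s\<close> and slots of path vertices.\<close>

definition trace :: "('v \<times> nat \<times> nat) + 'u \<Rightarrow> ((('v \<times> nat \<times> nat) + 'u) \<times> 'v) set \<Rightarrow> 'v list \<Rightarrow> bool" where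
  "trace s Q zs \<longleftrightarrow> snd ` Q = set zs \<and> fst ` Q \<subseteq> insert s {Inl (v, c, i) | v c i. v \<in> set zs} \<and>
    distinct zs \<and> zs \<noteq> [] \<and> hd zs \<in> nb s \<and> successively adj zs"

lemma good_new:
  assumes "good M'" "M \<subseteq> M'"
  shows "fst ` (M' - M) = fst ` M' - fst ` M" "snd ` (M' - M) = snd ` M' - snd ` M"
proof -
  have "inj_on fst M'" "inj_on snd M'"
    using assms(1) unfolding good_def by simp_all
  then show "fst ` (M' - M) = fst ` M' - fst ` M" "snd ` (M' - M) = snd ` M' - snd ` M"
    using assms(2) inj_on_image_set_diff[OF _ Diff_subset] by blast+
qed

lemma good_card:
  assumes "good M" shows "card (fst ` M) = card M" "card (snd ` M) = card M"
  using assms by (simp_all add: good_def card_image)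

lemma good_pair:
  assumes "good M" "(x, y) \<in> M"
  shows "x \<in> slots (host_verts - R) \<union> Inr ` U" "y \<in> host_verts - R" "y \<in> nb x"
proof -
  have "\<forall>(x, y)\<in>M. x \<in> slots (host_verts - R) \<union> Inr ` U \<and> y \<in> host_verts - R \<and> y \<in> nb x"
    using assms(1) unfolding good_def by (rule conjunct1)
  with assms(2) show "x \<in> slots (host_verts - R) \<union> Inr ` U" "y \<in> host_verts - R" "y \<in> nb x"
    by auto
qed

text \<open>
  \<open>M'\<close> arises from \<open>M\<close> by adding a tree of depth \<open>k\<close> hanging off the slot \<open>s\<close>, with one vertex on each
  of the first \<open>q\<close> levels and branching with arity \<open>d\<close> afterwards; \<open>Y\<close> is its last level.
\<close>

definition grown where
  "grown M s col k q M' Y \<longleftrightarrow> good M' \<and> M \<subseteq> M' \<and> fresh M' Y \<and>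
    fst ` M' \<subseteq> fst ` M \<union> {s} \<union> {Inl (v, c, i) | v c i. v \<in> snd ` M' - snd ` M} \<and>
    Y \<subseteq> snd ` M' - snd ` M \<and> Y \<subseteq> A (col k) \<and> card Y = d ^ (k - q) \<and>
    card M' = card M + (\<Sum>j\<le>k. d ^ (j - q)) \<and>
    (\<forall>y\<in>Y. \<exists>Q zs. Q \<subseteq> M' - M \<and> trace s Q zs \<and> length zs = Suc k \<and> last zs = y)"

text \<open>Level by level: by freshness the last level has all its child slots free, and
  \<open>good_fill\<close> fills the required ones. Consecutive colours differ, so these requests
  are legitimate slots.\<close>

lemma exists_grown:
  assumes M: "good M" "fresh M {}"
    and s: "s = Inl (v0, col 0, i0)" "s \<in> slots (host_verts - R)" "s \<notin> fst ` M" "v0 \<in> snd ` M"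
    and col: "\<And>j. col j < 3" "\<And>j. j < k \<Longrightarrow> col j \<noteq> col (Suc j)"
    and K: "card M + (\<Sum>j\<le>k. d ^ (j - q)) \<le> 6 * (d * m0)"
  shows "\<exists>M' Y. grown M s col k q M' Y"
  using col(2) K
proof (induction k)
  case 0
  have "card M \<le> 6 * (d * m0)" using 0 by simp
  then obtain y where y: "y \<in> nb s" "y \<in> host_verts - R" "y \<notin> snd ` M" "good (insert (s, y) M)"
    using good_extend[OF M(1), of s] s by blast
  let ?M = "insert (s, y) M"
  have 1: "card ?M = card M + (\<Sum>j\<le>0. d ^ (j - q))"
    using good_finite[OF M(1)] s(3) by (subst card_insert_disjoint) (auto simp: image_iff)
  have 2: "fresh ?M {y}"
    using M(2) s y unfolding fresh_def by auto
  have new: "{(s, y)} \<subseteq> ?M - M"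
    using s(3) by (auto simp: image_iff)
  have "trace s {(s, y)} [y]"
    using y by (simp add: trace_def)
  with new have 3: "\<forall>z\<in>{y}. \<exists>Q zs. Q \<subseteq> ?M - M \<and> trace s Q zs \<and> length zs = Suc 0 \<and> last zs = z"
    by (intro ballI exI[of _ "{(s, y)}"] exI[of _ "[y]"]) simp
  have 4: "{y} \<subseteq> A (col 0)" "card {y} = d ^ (0 - q)"
    using y(1) s(1) by simp_all
  have 5: "fst ` ?M \<subseteq> fst ` M \<union> {s} \<union> {Inl (v, c, i) | v c i. v \<in> snd ` ?M - snd ` M}"
    "{y} \<subseteq> snd ` ?M - snd ` M" "M \<subseteq> ?M"
    using y(3) by auto
  have "grown M s col 0 q ?M {y}"
    unfolding grown_def by (intro conjI 1 2 3 4 5 y(4))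
  then show ?case by blast
next
  case (Suc k)
  define r where "r = (if k < q then 1 else d)"
  have r: "r \<le> d" "d ^ (k - q) * r = d ^ (Suc k - q)"
    using d by (auto simp: r_def Suc_diff_le)
  have "card M + (\<Sum>j\<le>k. d ^ (j - q)) \<le> 6 * (d * m0)"
    using Suc.prems(2) by simp
  with Suc.IH Suc.prems(1) obtain M' Y where g: "grown M s col k q M' Y"
    using less_SucI by blast
  have M': "good M'" "M \<subseteq> M'" and fr: "fresh M' Y"
    and slotsM': "fst ` M' \<subseteq> fst ` M \<union> {s} \<union> {Inl (v, c, i) | v c i. v \<in> snd ` M' - snd ` M}"
    and Y: "Y \<subseteq> snd ` M' - snd ` M" "Y \<subseteq> A (col k)" "card Y = d ^ (k - q)"
    and cM': "card M' = card M + (\<Sum>j\<le>k. d ^ (j - q))"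
    and tr: "\<And>y. y \<in> Y \<Longrightarrow> \<exists>Q zs. Q \<subseteq> M' - M \<and> trace s Q zs \<and> length zs = Suc k \<and> last zs = y"
    using g unfolding grown_def by blast+
  define T :: "(('v \<times> nat \<times> nat) + 'u) set" where
    "T = (\<lambda>(y, i). Inl (y, col (Suc k), i)) ` (Y \<times> {..<r})"
  have "card T = card (Y \<times> {..<r})"
    unfolding T_def by (rule card_image) (auto simp: inj_on_def)
  then have cT: "card T = d ^ (Suc k - q)"
    using Y(3) r(2) by (simp add: card_cartesian_product)
  have YV: "Y \<subseteq> host_verts - R"
    using Y(1) good_pair(2)[OF M'(1)] by fastforce
  have "A (col k) \<inter> A (col (Suc k)) = {}"
    using disj col(1) Suc.prems(1)[of k] by blast
  then have TL: "T \<subseteq> slots (host_verts - R)"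
    using YV Y(2) col(1)[of "Suc k"] r(1) unfolding T_def slots_def by fastforce
  moreover have TM': "T \<inter> fst ` M' = {}"
    using fr unfolding T_def fresh_def by auto
  moreover have cle: "card M' + card T \<le> 6 * (d * m0)"
    using Suc.prems(2) cM' cT by simp
  ultimately obtain M'' where M'': "good M''" "M' \<subseteq> M''" "fst ` M'' = fst ` M' \<union> T"
    using good_fill[OF M'(1), of T] by blast
  let ?Y = "snd ` (M'' - M')"
  have Yeq: "?Y = snd ` M'' - snd ` M'" and fsteq: "fst ` (M'' - M') = T"
    using good_new[OF M''(1,2)] M''(3) TM' by auto
  have finM'': "finite M''" using good_finite[OF M''(1)] .
  have finM': "finite M'" using good_finite[OF M'(1)] .
  have finT: "finite T" using finM'' fsteq by (metis finite_Diff finite_imageI)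
  have "card M'' = card (fst ` M' \<union> T)"
    using good_card(1)[OF M''(1)] M''(3) by simp
  also have "\<dots> = card M' + card T"
    using good_card(1)[OF M'(1)] TM' finM' finT by (subst card_Un_disjoint) auto
  finally have cM'': "card M'' = card M' + card T" .
  have "card ?Y = card M'' - card M'"
    unfolding Yeq using good_card(2)[OF M''(1)] good_card(2)[OF M'(1)] M''(2) finM'
    by (subst card_Diff_subset) auto
  then have cY: "card ?Y = d ^ (Suc k - q)"
    using cM'' cT by simp
  have parent: "\<exists>y i. t = Inl (y, col (Suc k), i) \<and> y \<in> Y \<and> z \<in> A (col (Suc k)) \<and> adj y z"
    if "(t, z) \<in> M'' - M'" for t z
  proof -
    have "t \<in> T" using that fsteq by force
    then obtain y i where "t = Inl (y, col (Suc k), i)" "y \<in> Y" by (auto simp: T_def)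
    moreover have "z \<in> nb t" using good_pair(3)[OF M''(1)] that by blast
    ultimately show ?thesis by auto
  qed
  have YA: "?Y \<subseteq> A (col (Suc k))" using parent by fastforce
  have Ysub: "?Y \<subseteq> snd ` M'' - snd ` M" using Yeq M'(2) by auto
  have Tv: "v \<in> Y" if "Inl (v, c, i) \<in> T" for v c i using that by (auto simp: T_def)
  have mono: "snd ` M \<subseteq> snd ` M'" "snd ` M' \<subseteq> snd ` M''"
    using M'(2) M''(2) by (simp_all add: image_mono)
  have YM': "Y \<subseteq> snd ` M'" "Y \<subseteq> snd ` M'' - snd ` M" using Y(1) mono by blast+
  have fr'': "fresh M'' ?Y"
    unfolding fresh_def
  proof (intro allI impI)
    fix v c i assume "Inl (v, c, i) \<in> fst ` M''"
    then have "v \<in> snd ` M'"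
      unfolding M''(3) using fr Tv YM' unfolding fresh_def by blast
    then show "v \<in> snd ` M'' - ?Y"
      using mono Yeq by blast
  qed
  have sl'': "fst ` M'' \<subseteq> fst ` M \<union> {s} \<union> {Inl (v, c, i) | v c i. v \<in> snd ` M'' - snd ` M}"
  proof
    fix t assume "t \<in> fst ` M''"
    then consider "t \<in> fst ` M'" | "t \<in> T" using M''(3) by blast
    then show "t \<in> fst ` M \<union> {s} \<union> {Inl (v, c, i) | v c i. v \<in> snd ` M'' - snd ` M}"
    proof cases
      case 1
      then have "t \<in> fst ` M \<union> {s} \<union> {Inl (v, c, i) | v c i. v \<in> snd ` M' - snd ` M}"
        by (rule subsetD[OF slotsM'])
      then consider "t \<in> fst ` M" | "t = s" | v c i where "t = Inl (v, c, i)" "v \<in> snd ` M' - snd ` M"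
        by blast
      then show ?thesis
      proof cases
        case 3
        then have "v \<in> snd ` M'' - snd ` M" using mono by blast
        with 3 show ?thesis by blast
      qed simp_all
    next
      case 2
      then obtain y i where "t = Inl (y, col (Suc k), i)" "y \<in> Y" by (auto simp: T_def)
      moreover from this have "y \<in> snd ` M'' - snd ` M" using YM'(2) by blast
      ultimately show ?thesis by simp
    qed
  qed
  have tr'': "\<exists>Q zs. Q \<subseteq> M'' - M \<and> trace s Q zs \<and> length zs = Suc (Suc k) \<and> last zs = z"
    if z: "z \<in> ?Y" for z
  proof -
    obtain t where t: "(t, z) \<in> M'' - M'" using z by auto
    then obtain y i where y: "t = Inl (y, col (Suc k), i)" "y \<in> Y" "adj y z"
      using parent by blast
    obtain Q zs where Q: "Q \<subseteq> M' - M" "trace s Q zs" "length zs = Suc k" "last zs = y"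
      using tr[OF y(2)] by auto
    have zz: "z \<notin> snd ` M'" using z Yeq by blast
    have q: "snd ` Q = set zs" "fst ` Q \<subseteq> insert s {Inl (v, c, i) | v c i. v \<in> set zs}"
      "distinct zs" "zs \<noteq> []" "hd zs \<in> nb s" "successively adj zs"
      using Q(2) unfolding trace_def by blast+
    have "snd ` Q \<subseteq> snd ` M'" using Q(1) by (intro image_mono) blast
    then have "z \<notin> set zs" using zz q(1) by blast
    moreover have "y \<in> set zs" using Q(4) q(4) by auto
    moreover have "insert s {Inl (v, c, i) | v c i. v \<in> set zs}
        \<subseteq> insert s {Inl (v, c, i) | v c i. v \<in> set (zs @ [z])}"
      by (intro insert_mono Collect_mono) auto
    then have "fst ` Q \<subseteq> insert s {Inl (v, c, i) | v c i. v \<in> set (zs @ [z])}"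
      using q(2) by (rule order_trans[rotated])
    ultimately have "trace s (insert (t, z) Q) (zs @ [z])"
      using q y(1,3) Q(4) unfolding trace_def
      by (simp add: successively_append_iff)
    moreover have "insert (t, z) Q \<subseteq> M'' - M"
      using Q(1) t M'(2) M''(2) by blast
    ultimately show ?thesis using Q(3)
      by (intro exI[of _ "insert (t, z) Q"] exI[of _ "zs @ [z]"]) simp
  qed
  have "card M'' = card M + (\<Sum>j\<le>Suc k. d ^ (j - q))"
    using cM'' cM' cT by simp
  moreover have "M \<subseteq> M''" using M'(2) M''(2) by blast
  ultimately have "grown M s col (Suc k) q M'' ?Y"
    unfolding grown_def using M''(1) fr'' sl'' Ysub YA cY tr''
    by (intro conjI ballI) assumption+
  then show ?case by blast
qed

text \<open>The tree at \<open>s1\<close> starts with a path and the one at \<open>s2\<close>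
  branches at once; each ends in \<open>d ^ h\<close> leaves, which is at least \<open>m0\<close>,
  so \<open>join\<close> yields an edge between the two last levels. \<open>w\<close> prescribes the
  part of every position on the path.\<close>

lemma exists_connecting_path:
  assumes M: "good M" "fresh M {}"
    and s1: "s1 = Inl (v1, w 1, i1)" "s1 \<in> slots (host_verts - R)" "s1 \<notin> fst ` M" "v1 \<in> snd ` M"
    and s2: "s2 = Inl (v2, w (l - 1), i2)" "s2 \<in> slots (host_verts - R)" "s2 \<notin> fst ` M" "v2 \<in> snd ` M"
    and ne: "s1 \<noteq> s2"
    and w: "\<And>t. w t < 3" "\<And>t. t < l \<Longrightarrow> w t \<noteq> w (Suc t)"
    and h: "m0 \<le> d ^ h" "d ^ h \<le> d * m0" "2 * h + 3 \<le> l"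
    and K: "card M + l \<le> 2 * (d * m0)"
  shows "\<exists>M' zs. good M' \<and> M \<subseteq> M' \<and> length zs = l - 1 \<and> distinct zs \<and> set zs \<inter> snd ` M = {} \<and>
    snd ` M' = snd ` M \<union> set zs \<and>
    fst ` M' \<subseteq> fst ` M \<union> {s1, s2} \<union> {Inl (v, c, i) | v c i. v \<in> set zs} \<and>
    successively adj zs \<and> adj v1 (hd zs) \<and> adj v2 (last zs)"
proof -
  \<comment> \<open>The final path has \<open>k + 1\<close> vertices from the first tree and
    \<open>h + 1\<close> from the second, in total \<open>l - 1\<close>. The bound
    \<open>2 * h + 3 \<le> l\<close> gives \<open>h \<le> k\<close>, so the last \<open>h\<close>
    levels of the first tree can branch.\<close>
  define k q where "k = l - 3 - h" and "q = k - h"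
  have kq: "k = q + h" using h(3) by (simp add: k_def q_def)
  have lk: "l = k + h + 3" using h(3) by (simp add: k_def)
  have sum1: "(\<Sum>j\<le>k. d ^ (j - q)) \<le> q + 2 * d ^ h"
    unfolding kq by (rule sum_level_sizes[OF d])
  have sum2: "(\<Sum>j\<le>h. d ^ (j - 0)) \<le> 2 * d ^ h"
    using sum_level_sizes[OF d, of 0 h] by simp
  have "card M + (\<Sum>j\<le>k. d ^ (j - q)) \<le> 6 * (d * m0)"
    using sum1 K h(2) lk kq by linarith
  moreover have "w (1 + j) \<noteq> w (1 + Suc j)" if "j < k" for j
    using w(2)[of "1 + j"] that lk by simp
  ultimately obtain M1 Y1 where g1: "grown M s1 (\<lambda>j. w (1 + j)) k q M1 Y1"
    using exists_grown[where col = "\<lambda>j. w (1 + j)" and k = k and q = q and s = s1 and M = M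
        and ?v0.0 = v1 and ?i0.0 = i1] M s1 w(1) by auto
  have M1: "good M1" "M \<subseteq> M1" "fresh M1 Y1"
    and sl1: "fst ` M1 \<subseteq> fst ` M \<union> {s1} \<union> {Inl (v, c, i) | v c i. v \<in> snd ` M1 - snd ` M}"
    and Y1: "Y1 \<subseteq> snd ` M1 - snd ` M" "Y1 \<subseteq> A (w (1 + k))" "card Y1 = d ^ (k - q)"
    and c1: "card M1 = card M + (\<Sum>j\<le>k. d ^ (j - q))"
    and tr1: "\<forall>y\<in>Y1. \<exists>Q zs. Q \<subseteq> M1 - M \<and> trace s1 Q zs \<and> length zs = Suc k \<and> last zs = y"
    using g1 unfolding grown_def by blast+
  \<comment> \<open>Its owner was embedded before, while slots added by the first tree belong to new
    vertices or equal \<open>s1\<close>.\<close>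
  have s2M1: "s2 \<notin> fst ` M1"
    using sl1 s2 ne by auto
  have v2M1: "v2 \<in> snd ` M1" using s2 M1(2) by auto
  have frM1: "fresh M1 {}" using M1(3) unfolding fresh_def by blast
  \<comment> \<open>The second tree reads the walk backwards from position
    \<open>l - 1\<close>.\<close>
  have col2: "w (l - 1 - j) \<noteq> w (l - 1 - Suc j)" if "j < h" for j
  proof -
    have "l - 1 - j = Suc (l - 1 - Suc j)" using that lk by simp
    moreover have "l - 1 - Suc j < l" using lk by simp
    ultimately show ?thesis using w(2)[of "l - 1 - Suc j"] by metis
  qed
  \<comment> \<open>This is where \<open>6 * (d * m0)\<close> comes from:
    \<open>2 * (d * m0)\<close> for \<open>M\<close> and the path, and \<open>2 * (d * m0)\<close>
    for the branching part of each tree.\<close>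
  have "card M1 + (\<Sum>j\<le>h. d ^ (j - 0)) \<le> 6 * (d * m0)"
    using sum1 sum2 c1 K h(2) lk kq by linarith
  then obtain M2 Y2 where g2: "grown M1 s2 (\<lambda>j. w (l - 1 - j)) h 0 M2 Y2"
    using exists_grown[where col = "\<lambda>j. w (l - 1 - j)" and k = h and q = 0 and s = s2 and M = M1
        and ?v0.0 = v2 and ?i0.0 = i2] M1(1) frM1 s2(1,2) s2M1 v2M1 w(1) col2 by auto
  have M2: "good M2" "M1 \<subseteq> M2"
    and Y2: "Y2 \<subseteq> snd ` M2 - snd ` M1" "Y2 \<subseteq> A (w (l - 1 - h))" "card Y2 = d ^ (h - 0)"
    and tr2: "\<forall>y\<in>Y2. \<exists>Q zs. Q \<subseteq> M2 - M1 \<and> trace s2 Q zs \<and> length zs = Suc h \<and> last zs = y"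
    using g2 unfolding grown_def by blast+
  \<comment> \<open>The two sets of leaves sit at the consecutive positions \<open>k + 1\<close> and
    \<open>k + 2\<close> of the walk, hence in different parts.\<close>
  have eqs: "l - 1 - h = Suc (1 + k)" "k - q = h" using lk kq by auto
  have "w (1 + k) \<noteq> w (l - 1 - h)"
    unfolding eqs using w(2)[of "1 + k"] lk by simp
  then obtain y z where yz: "y \<in> Y1" "z \<in> Y2" "adj y z"
    using join[OF w(1) w(1), of "1 + k" "l - 1 - h" Y1 Y2] Y1 Y2 h(1) eqs by auto
  obtain Q1 zs1 where Q1: "Q1 \<subseteq> M1 - M" "trace s1 Q1 zs1" "length zs1 = Suc k" "last zs1 = y"
    using tr1 yz(1) by blast
  obtain Q2 zs2 where Q2: "Q2 \<subseteq> M2 - M1" "trace s2 Q2 zs2" "length zs2 = Suc h" "last zs2 = z"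
    using tr2 yz(2) by blast
  have new1: "set zs1 \<subseteq> snd ` M1 - snd ` M"
    using Q1(1,2) good_new(2)[OF M1(1,2)] unfolding trace_def by blast
  have new2: "set zs2 \<subseteq> snd ` M2 - snd ` M1"
    using Q2(1,2) good_new(2)[OF M2(1,2)] unfolding trace_def by blast
  \<comment> \<open>Rollback: both trees are dropped except for the two branches leading to the
    edge; the second branch was grown from the far end and is reversed.\<close>
  let ?M = "M \<union> Q1 \<union> Q2" and ?zs = "zs1 @ rev zs2"
  have ne12: "zs1 \<noteq> []" "zs2 \<noteq> []" using Q1(3) Q2(3) by auto
  have "good ?M"
    by (rule good_subset[OF M2(1)]) (use Q1(1) Q2(1) M1(2) M2(2) in blast)
  moreover have "length ?zs = l - 1"
    using Q1(3) Q2(3) lk by simp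
  moreover have "distinct ?zs"
    using Q1(2) Q2(2) new1 new2 unfolding trace_def by auto
  moreover have "set ?zs \<inter> snd ` M = {}"
    using new1 new2 M1(2) by auto
  moreover have "snd ` ?M = snd ` M \<union> set ?zs"
    using Q1(2) Q2(2) unfolding trace_def by (simp add: image_Un Un_assoc)
  moreover have "fst ` ?M \<subseteq> fst ` M \<union> {s1, s2} \<union> {Inl (v, c, i) | v c i. v \<in> set ?zs}"
  proof -
    have "fst ` Q1 \<subseteq> insert s1 {Inl (v, c, i) | v c i. v \<in> set zs1}"
      "fst ` Q2 \<subseteq> insert s2 {Inl (v, c, i) | v c i. v \<in> set zs2}"
      using Q1(2) Q2(2) unfolding trace_def by blast+
    then show ?thesis by (auto simp: image_Un)
  qed
  moreover have "successively adj ?zs"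
  proof -
    have "successively (\<lambda>x y. adj y x) zs2"
      using Q2(2) adj_sym unfolding trace_def by (auto intro: successively_mono)
    then show ?thesis
      using Q1(2,4) Q2(2,4) yz(3) ne12 unfolding trace_def
      by (simp add: successively_append_iff hd_rev)
  qed
  moreover have "adj v1 (hd ?zs)" "adj v2 (last ?zs)"
    using Q1(2) Q2(2) s1(1) s2(1) ne12 unfolding trace_def by (simp_all add: last_rev)
  moreover have "M \<subseteq> ?M" by blast
  ultimately show ?thesis by blast
qed

end

section \<open>Embedding subdivisions\<close>

text \<open>For odd \<open>l\<close> the closed walk detours through \<open>2\<close> just before it returns; values beyond \<open>l\<close> are junk.\<close>

definition triangle_walk :: "nat \<Rightarrow> nat \<Rightarrow> nat" where
  "triangle_walk l t = (if t = l then 0 else if odd l \<and> Suc t = l then 2 else t mod 2)"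

lemma triangle_walk_less: "triangle_walk l t < 3"
proof -
  have "t mod 2 < 2" by simp
  then have "t mod 2 < 3" by linarith
  then show ?thesis by (simp add: triangle_walk_def)
qed

lemma triangle_walk_step:
  assumes "t < l" "2 \<le> l" shows "triangle_walk l t \<noteq> triangle_walk l (Suc t)"
proof -
  consider "Suc t = l" | "Suc (Suc t) = l" | "Suc (Suc t) < l"
    using assms by linarith
  then show ?thesis
    using assms by cases (auto simp: triangle_walk_def mod_2_eq_odd)
qed

text \<open>Branch vertices lie in \<open>A 0\<close>, so they only have slots towards the other two
  parts.\<close>

lemma triangle_walk_ends:
  assumes "3 \<le> l" shows "triangle_walk l 1 \<noteq> 0" "triangle_walk l (l - 1) \<noteq> 0"
proof -
  show "triangle_walk l 1 \<noteq> 0"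
    using assms by (auto simp: triangle_walk_def)
  show "triangle_walk l (l - 1) \<noteq> 0"
    using assms by (cases l) (auto simp: triangle_walk_def mod_2_eq_odd)
qed

lemma Min_Max_edge:
  fixes e :: "'a::linorder set"
  assumes "card e = 2"
  shows "Min e \<in> e" "Max e \<in> e" "Min e \<noteq> Max e"
proof -
  obtain x y where "e = {x, y}" "x \<noteq> y"
    using assms by (auto simp: card_2_iff)
  then show "Min e \<in> e" "Max e \<in> e" "Min e \<noteq> Max e"
    by (auto simp: min_def max_def)
qed

text \<open>All branch vertices are placed in \<open>A 0\<close> first, then the edges are processed
  one after another, each path following \<open>triangle_walk\<close>. Since degrees are at most
  \<open>d\<close>, each edge at a branch vertex can own a private slot index.\<close>

lemma embed_subdivision:
  fixes A :: "nat \<Rightarrow> 'v set" and H :: "'a::linorder ugraph"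
  assumes host: "host A adj m0 d (verts H)"
    and H: "finite_graph H" "max_degree_le H d"
    and \<sigma>: "\<And>e. e \<in> edges H \<Longrightarrow> 2 * h + 3 \<le> \<sigma> e"
    and small: "nv (subdivision H \<sigma>) \<le> m0"
    and h: "m0 \<le> d ^ h" "d ^ h \<le> d * m0"
  shows "\<exists>f. inj_on f (verts (subdivision H \<sigma>)) \<and> f ` verts (subdivision H \<sigma>) \<subseteq> (\<Union>c<3. A c) \<and>
    (\<forall>e\<in>edges (subdivision H \<sigma>). \<exists>x y. f ` e = {x, y} \<and> adj x y)"
proof -
  interpret host A adj m0 d "verts H" by (rule host)
  obtain R where R: "finite R" "card R \<le> 9 * (d * m0)"
    "small_hall (2 * (9 * (d * m0))) nb (slots (host_verts - R)) (host_verts - R)"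
    using exists_small_hall by blast
  interpret clean_host A adj m0 d "verts H" R
    by unfold_locales (rule R)+
  have finE: "finite (edges H)"
    using H(1) unfolding finite_graph_def by (meson PowI finite_Pow_iff finite_subset subsetI)
  have edge: "Min e \<in> e" "Max e \<in> e" "Min e \<noteq> Max e" "e \<subseteq> verts H" if "e \<in> edges H" for e
    using H(1) that Min_Max_edge[of e] unfolding finite_graph_def by auto
  have nvs: "nv (subdivision H \<sigma>) = card (verts H) + (\<Sum>e\<in>edges H. \<sigma> e - 1)"
    using finite_graph_subdivision(2)[OF H(1), of \<sigma>] \<sigma> by (fastforce simp: nv_def)
  have dm: "m0 \<le> d * m0" using d by simp
  have "\<exists>g. g ` {e \<in> edges H. u \<in> e} \<subseteq> {..<d} \<and> inj_on g {e \<in> edges H. u \<in> e}" if "u \<in> verts H" for u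
    using H(2) that finE unfolding max_degree_le_def vertex_degree_def
    by (intro card_le_inj) auto
  then obtain idx where idx: "\<And>u. u \<in> verts H \<Longrightarrow> idx u ` {e \<in> edges H. u \<in> e} \<subseteq> {..<d}"
    "\<And>u. u \<in> verts H \<Longrightarrow> inj_on (idx u) {e \<in> edges H. u \<in> e}"
    by metis
  have "card (Inr ` verts H :: (('v \<times> nat \<times> nat) + 'a) set) = card (verts H)"
    by (rule card_image) simp
  then obtain M0 where M0: "good M0" "fst ` M0 = Inr ` verts H"
    using good_fill[OF good_empty, of "Inr ` verts H"] small nvs dm by auto
  then have "\<forall>u\<in>verts H. \<exists>v. (Inr u, v) \<in> M0"
    by (metis (no_types, lifting) imageE image_eqI prod.collapse)
  then obtain \<rho> where \<rho>: "\<And>u. u \<in> verts H \<Longrightarrow> (Inr u, \<rho> u) \<in> M0"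
    by metis
  have inj0: "inj_on fst M0" "inj_on snd M0"
    using M0(1) unfolding good_def by simp_all
  have snd0: "snd ` M0 = \<rho> ` verts H"
  proof
    show "\<rho> ` verts H \<subseteq> snd ` M0" using \<rho> by force
    show "snd ` M0 \<subseteq> \<rho> ` verts H"
    proof
      fix v assume "v \<in> snd ` M0"
      then obtain s where s: "(s, v) \<in> M0" by auto
      then have "s \<in> Inr ` verts H" unfolding M0(2)[symmetric] by force
      then obtain u where u: "s = Inr u" "u \<in> verts H" by blast
      then have "(s, v) = (Inr u, \<rho> u)"
        using inj_onD[OF inj0(1) _ s \<rho>[OF u(2)]] by simp
      then show "v \<in> \<rho> ` verts H" using u by simp
    qed
  qed
  have inj\<rho>: "inj_on \<rho> (verts H)"
  proof (rule inj_onI)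
    fix u v assume uv: "u \<in> verts H" "v \<in> verts H" "\<rho> u = \<rho> v"
    then have "(Inr u, \<rho> u) = (Inr v, \<rho> v)"
      using inj_onD[OF inj0(2) _ \<rho> \<rho>] by simp
    then show "u = v" by simp
  qed
  have \<rho>A: "\<rho> u \<in> A 0" "\<rho> u \<in> host_verts - R" if "u \<in> verts H" for u
    using good_pair(2,3)[OF M0(1) \<rho>[OF that]] by simp_all
  have root_slot: "Inl (\<rho> u, c, idx u e) \<in> slots (host_verts - R)"
    if "u \<in> e" "e \<in> edges H" "c < 3" "c \<noteq> 0" for u e c
  proof -
    have u: "u \<in> verts H" using that edge(4) by blast
    have "\<rho> u \<notin> A c" using disj[of 0 c] \<rho>A[OF u] that by auto
    moreover have "idx u e < d" using idx(1)[OF u] that by auto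
    ultimately show ?thesis using \<rho>A[OF u] that by (auto simp: slots_def)
  qed
  define path_ok where "path_ok e xs \<longleftrightarrow> length xs = \<sigma> e - 1 \<and> distinct xs \<and>
    set xs \<inter> \<rho> ` verts H = {} \<and> successively adj (\<rho> (Min e) # xs @ [\<rho> (Max e)])" for e xs
  define Inv where "Inv F M p \<longleftrightarrow> good M \<and> M0 \<subseteq> M \<and> fresh M {} \<and>
    (\<forall>u\<in>verts H. \<forall>c i. Inl (\<rho> u, c, i) \<in> fst ` M \<longrightarrow> (\<exists>e\<in>F. u \<in> e \<and> i = idx u e)) \<and>
    snd ` M = \<rho> ` verts H \<union> (\<Union>e\<in>F. set (p e)) \<and>
    (\<forall>e\<in>F. path_ok e (p e)) \<and>
    (\<forall>e\<in>F. \<forall>e'\<in>F. e \<noteq> e' \<longrightarrow> set (p e) \<inter> set (p e') = {})"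
    for F M and p :: "'a set \<Rightarrow> 'v list"
  have "\<exists>M p. Inv F M p" if "finite F" "F \<subseteq> edges H" for F
    using that
  proof (induction F rule: finite_induct)
    case empty
    have "fresh M0 {}" using M0(2) unfolding fresh_def by auto
    then have "Inv {} M0 (\<lambda>_. [])"
      unfolding Inv_def using M0 snd0 by auto
    then show ?case by blast
  next
    case (insert e F)
    then obtain M p where "Inv F M p" by blast
    note I = this[unfolded Inv_def]
    have M: "good M" "M0 \<subseteq> M" "fresh M {}"
      and root: "\<forall>u\<in>verts H. \<forall>c i. Inl (\<rho> u, c, i) \<in> fst ` M \<longrightarrow> (\<exists>e\<in>F. u \<in> e \<and> i = idx u e)"
      and sndM: "snd ` M = \<rho> ` verts H \<union> (\<Union>e\<in>F. set (p e))"
      and p: "\<forall>e\<in>F. path_ok e (p e)"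
      and pdisj: "\<forall>e\<in>F. \<forall>e'\<in>F. e \<noteq> e' \<longrightarrow> set (p e) \<inter> set (p e') = {}"
      using I by - (elim conjE, assumption)+
    have e: "e \<in> edges H" "e \<notin> F" "F \<subseteq> edges H" using insert by auto
    let ?l = "\<sigma> e" and ?u = "Min e" and ?v = "Max e"
    let ?w = "triangle_walk ?l"
    have l: "2 * h + 3 \<le> ?l" using \<sigma> e by blast
    have uv: "?u \<in> e" "?v \<in> e" "?u \<noteq> ?v" "?u \<in> verts H" "?v \<in> verts H"
      using edge[OF e(1)] by auto
    have unused: "Inl (\<rho> u, c, idx u e) \<notin> fst ` M" if u: "u \<in> e" for u c
    proof
      assume a: "Inl (\<rho> u, c, idx u e) \<in> fst ` M"
      have uH: "u \<in> verts H" using u edge(4)[OF e(1)] by blast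
      obtain e' where e': "e' \<in> F" "u \<in> e'" "idx u e = idx u e'"
        using root uH a by blast
      have "e = e'"
        by (rule inj_onD[OF idx(2)[OF uH] e'(3)]) (use e e' u in auto)
      with e' e show False by simp
    qed
    \<comment> \<open>Occupied vertices and the inner vertices of the new path together number at
      most \<open>nv (subdivision H \<sigma>)\<close>, hence at most \<open>m0\<close>; the factor
      \<open>2\<close> absorbs the difference between \<open>\<sigma> e - 1\<close> and
      \<open>\<sigma> e\<close>.\<close>
    have "card M = card (snd ` M)" using good_card(2)[OF M(1)] by simp
    also have "\<dots> \<le> card (\<rho> ` verts H) + card (\<Union>e\<in>F. set (p e))"
      unfolding sndM by (rule card_Un_le)
    also have "card (\<rho> ` verts H) = card (verts H)" using inj\<rho> by (rule card_image)
    also have "card (\<Union>e\<in>F. set (p e)) \<le> (\<Sum>e\<in>F. card (set (p e)))"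
      using insert(1) by (rule card_UN_le)
    also have "\<dots> \<le> (\<Sum>e\<in>F. \<sigma> e - 1)"
      using p unfolding path_ok_def by (intro sum_mono) (metis card_length)
    finally have "card M + (\<sigma> e - 1) \<le> card (verts H) + (\<Sum>e\<in>insert e F. \<sigma> e - 1)"
      using insert(1,2) by simp
    also have "\<dots> \<le> card (verts H) + (\<Sum>e\<in>edges H. \<sigma> e - 1)"
      using finE insert(4) by (intro add_left_mono sum_mono2) auto
    also have "\<dots> \<le> m0" using small nvs by simp
    finally have K: "card M + ?l \<le> 2 * (d * m0)" using m0 dm l by linarith
    have v_in: "\<rho> ?u \<in> snd ` M" "\<rho> ?v \<in> snd ` M" using sndM uv by auto
    have ne: "Inl (\<rho> ?u, ?w 1, idx ?u e) \<noteq> (Inl (\<rho> ?v, ?w (?l - 1), idx ?v e) :: ('v \<times> nat \<times> nat) + 'a)"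
      using inj_onD[OF inj\<rho> _ uv(4,5)] uv(3) by auto
    obtain M' zs where M': "good M'" "M \<subseteq> M'" and zs: "length zs = ?l - 1" "distinct zs"
        "set zs \<inter> snd ` M = {}" "snd ` M' = snd ` M \<union> set zs"
      and fstM': "fst ` M' \<subseteq> fst ` M \<union> {Inl (\<rho> ?u, ?w 1, idx ?u e), Inl (\<rho> ?v, ?w (?l - 1), idx ?v e)}
        \<union> {Inl (v, c, i) | v c i. v \<in> set zs}"
      and adj: "successively adj zs" "adj (\<rho> ?u) (hd zs)" "adj (\<rho> ?v) (last zs)"
      using exists_connecting_path[OF M(1,3) refl root_slot[OF uv(1) e(1)] unused[OF uv(1)] v_in(1)
          refl root_slot[OF uv(2) e(1)] unused[OF uv(2)] v_in(2) ne, of h]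
        triangle_walk_less triangle_walk_step[of _ ?l] triangle_walk_ends[of ?l] h l K
      by auto
    have zs_ne: "zs \<noteq> []" using zs(1) l by auto
    let ?p = "p(e := zs)"
    have newslot: "(\<exists>u\<in>{?u, ?v}. v = \<rho> u \<and> i = idx u e) \<or> v \<in> set zs \<or> Inl (v, c, i) \<in> fst ` M"
      if "Inl (v, c, i) \<in> fst ` M'" for v c i
      using subsetD[OF fstM' that] by auto
    have "fresh M' {}"
      unfolding fresh_def
    proof (intro allI impI)
      fix v c i assume "Inl (v, c, i) \<in> fst ` M'"
      from newslot[OF this] have "v \<in> snd ` M \<or> v \<in> set zs"
      proof (elim disjE)
        assume "Inl (v, c, i) \<in> fst ` M"
        then show ?thesis using M(3) unfolding fresh_def by blast
      qed (use v_in in blast)+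
      then show "v \<in> snd ` M' - {}"
        using zs(4) by blast
    qed
    moreover have "\<exists>e'\<in>insert e F. u \<in> e' \<and> i = idx u e'"
      if u: "u \<in> verts H" and i: "Inl (\<rho> u, c, i) \<in> fst ` M'" for u c i
      using newslot[OF i]
    proof (elim disjE)
      assume "\<exists>u'\<in>{?u, ?v}. \<rho> u = \<rho> u' \<and> i = idx u' e"
      then have "u \<in> {?u, ?v} \<and> i = idx u e"
        using inj_onD[OF inj\<rho> _ u] uv by blast
      then show ?thesis using uv by blast
    next
      assume "\<rho> u \<in> set zs"
      then show ?thesis using zs(3) sndM u by auto
    next
      assume "Inl (\<rho> u, c, i) \<in> fst ` M"
      then show ?thesis using root u by blast
    qed
    moreover have "snd ` M' = \<rho> ` verts H \<union> (\<Union>e\<in>insert e F. set (?p e))"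
    proof -
      have "?p e' = p e'" if "e' \<in> F" for e' using e(2) that by auto
      then have "(\<Union>e\<in>F. set (?p e)) = (\<Union>e\<in>F. set (p e))" by simp
      then show ?thesis using zs(4) sndM by auto
    qed
    moreover have "path_ok e' (?p e')" if "e' \<in> insert e F" for e'
    proof (cases "e' = e")
      case True
      have "set zs \<inter> \<rho> ` verts H = {}" using zs(3) sndM by auto
      moreover have "successively adj (\<rho> ?u # zs @ [\<rho> ?v])"
        using adj zs_ne adj_sym by (auto simp: successively_Cons successively_append_iff)
      ultimately show ?thesis using True zs by (simp add: path_ok_def)
    next
      case False
      then show ?thesis using p that by simp
    qed
    moreover have "set (?p e1) \<inter> set (?p e2) = {}"
      if e12: "e1 \<in> insert e F" "e2 \<in> insert e F" "e1 \<noteq> e2" for e1 e2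
    proof -
      have new: "set zs \<inter> set (p e') = {}" if "e' \<in> F" for e' using zs(3) sndM that by blast
      consider "e1 = e" "e2 \<in> F" "e2 \<noteq> e" | "e2 = e" "e1 \<in> F" "e1 \<noteq> e"
        | "e1 \<in> F" "e2 \<in> F" "e1 \<noteq> e" "e2 \<noteq> e"
        using e12 e(2) by blast
      then show ?thesis
      proof cases
        case 1
        then show ?thesis using new[of e2] by simp
      next
        case 2
        then show ?thesis using new[of e1] by (simp add: Int_commute)
      next
        case 3
        then show ?thesis using pdisj e12(3) by simp
      qed
    qed
    moreover have "M0 \<subseteq> M'" using M(2) M'(2) by blast
    ultimately have "Inv (insert e F) M' ?p"
      unfolding Inv_def by (intro conjI M'(1) ballI allI impI)
    then show ?case by blast
  qed
  then obtain M p where "Inv (edges H) M p" using finE by blast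
  note I = this[unfolded Inv_def]
  have M: "good M" and sndM: "snd ` M = \<rho> ` verts H \<union> (\<Union>e\<in>edges H. set (p e))"
    and path: "\<forall>e\<in>edges H. path_ok e (p e)"
    and pdisj: "\<forall>e\<in>edges H. \<forall>e'\<in>edges H. e \<noteq> e' \<longrightarrow> set (p e) \<inter> set (p e') = {}"
    using I by - (elim conjE, assumption)+
  note p = path[unfolded path_ok_def]
  \<comment> \<open>Inner vertices are numbered from \<open>1\<close> and list positions from
    \<open>0\<close>, whence \<open>i - 1\<close>; the endpoints are not stored in
    \<open>p e\<close>.\<close>
  define f where "f x = (case x of Inl u \<Rightarrow> \<rho> u | Inr (e, i) \<Rightarrow> p e ! (i - 1))" for x
  have f_simps: "f (Inl u) = \<rho> u" "f (Inr (e, i)) = p e ! (i - 1)" for u e i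
    by (simp_all add: f_def)
  have in_path: "f (Inr (e, i)) \<in> set (p e)" if "e \<in> edges H" "0 < i" "i < \<sigma> e" for e i
    unfolding f_simps using bspec[OF p that(1)] that(2,3) by (intro nth_mem) linarith
  have vs: "x \<in> verts (subdivision H \<sigma>) \<longleftrightarrow>
      (\<exists>u\<in>verts H. x = Inl u) \<or> (\<exists>e\<in>edges H. \<exists>i. 0 < i \<and> i < \<sigma> e \<and> x = Inr (e, i))" for x
    by (auto simp: subdivision_def)
  have "inj_on f (verts (subdivision H \<sigma>))"
  proof (rule inj_onI)
    fix x y assume x: "x \<in> verts (subdivision H \<sigma>)" and y: "y \<in> verts (subdivision H \<sigma>)" and eq: "f x = f y"
    have inl_inr: False if "u \<in> verts H" "e \<in> edges H" "0 < i" "i < \<sigma> e" "f (Inl u) = f (Inr (e, i))" for u e i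
    proof -
      have "\<rho> u \<in> set (p e)" using in_path[OF that(2-4)] that(5) by (simp add: f_simps(1))
      moreover have "set (p e) \<inter> \<rho> ` verts H = {}" using bspec[OF p that(2)] by simp
      ultimately show False using that(1) by blast
    qed
    have inr: "e = e' \<and> i = i'"
      if i: "e \<in> edges H" "0 < i" "i < \<sigma> e" and i': "e' \<in> edges H" "0 < i'" "i' < \<sigma> e'"
        and eq: "f (Inr (e, i)) = f (Inr (e', i'))" for e i e' i'
    proof -
      have "f (Inr (e, i)) \<in> set (p e) \<inter> set (p e')"
        using in_path[OF i] in_path[OF i'] eq by simp
      then have "e = e'"
        using pdisj i(1) i'(1) by blast
      moreover from this have "i - 1 = i' - 1"
        using bspec[OF p i(1)] i i' eq nth_eq_iff_index_eq[of "p e" "i - 1" "i' - 1"]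
        by (simp add: f_simps)
      ultimately show ?thesis using i i' by simp
    qed
    consider (ll) u v where "u \<in> verts H" "v \<in> verts H" "x = Inl u" "y = Inl v"
      | (lr) u e i where "u \<in> verts H" "e \<in> edges H" "0 < i" "i < \<sigma> e" "x = Inl u" "y = Inr (e, i)"
      | (rl) u e i where "u \<in> verts H" "e \<in> edges H" "0 < i" "i < \<sigma> e" "y = Inl u" "x = Inr (e, i)"
      | (rr) e i e' i' where "e \<in> edges H" "0 < i" "i < \<sigma> e" "e' \<in> edges H" "0 < i'" "i' < \<sigma> e'"
        "x = Inr (e, i)" "y = Inr (e', i')"
      using x y unfolding vs by blast
    then show "x = y"
    proof cases
      case ll
      then show ?thesis using eq inj\<rho> unfolding f_simps by (auto simp: f_simps inj_on_def)
    next
      case lr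
      then show ?thesis using inl_inr eq by blast
    next
      case rl
      then show ?thesis using inl_inr eq by metis
    next
      case rr
      then show ?thesis using inr eq by blast
    qed
  qed
  moreover have "f ` verts (subdivision H \<sigma>) \<subseteq> (\<Union>c<3. A c)"
  proof
    fix y assume "y \<in> f ` verts (subdivision H \<sigma>)"
    then obtain x where x: "x \<in> verts (subdivision H \<sigma>)" "y = f x" by blast
    then have "y \<in> snd ` M"
      unfolding vs sndM using in_path f_simps(1) by blast
    then have "y \<in> host_verts" using good_pair(2)[OF M] by fastforce
    then show "y \<in> (\<Union>c<3. A c)" by (simp add: host_verts_def)
  qed
  moreover have "\<exists>x y. f ` d = {x, y} \<and> adj x y" if d_edge: "d \<in> edges (subdivision H \<sigma>)" for d
  proof -
    obtain e i where e: "e \<in> edges H" "i < \<sigma> e" "d = {subdiv_vertex \<sigma> e i, subdiv_vertex \<sigma> e (Suc i)}"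
      using d_edge by (auto simp: subdivision_def)
    let ?q = "\<rho> (Min e) # p e @ [\<rho> (Max e)]"
    have len: "length (p e) = \<sigma> e - 1" using bspec[OF p e(1)] by blast
    have pos: "3 \<le> \<sigma> e" using \<sigma>[OF e(1)] by linarith
    have q: "f (subdiv_vertex \<sigma> e j) = ?q ! j" if j: "j \<le> \<sigma> e" for j
    proof -
      consider "j = 0" | "j = \<sigma> e" | "0 < j" "j < \<sigma> e" using j by linarith
      then show ?thesis
      proof cases
        case 1
        then show ?thesis by (simp add: subdiv_vertex_def f_simps)
      next
        case 2
        then show ?thesis using pos len by (simp add: subdiv_vertex_def f_simps nth_Cons' nth_append)
      next
        case 3
        then have "j - 1 < length (p e)" using len by linarith
        then show ?thesis using 3 by (simp add: subdiv_vertex_def f_simps nth_Cons' nth_append)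
      qed
    qed
    have "adj (?q ! i) (?q ! Suc i)"
      by (rule successively_nth) (use bspec[OF p e(1)] e(2) len in auto)
    moreover have "f ` d = {?q ! i, ?q ! Suc i}"
      using e(2,3) q[of i] q[of "Suc i"] by simp
    ultimately show ?thesis by blast
  qed
  ultimately show ?thesis by blast
qed

section \<open>A full monochromatic triple\<close>

definition full :: "('v \<Rightarrow> 'v \<Rightarrow> bool) \<Rightarrow> real \<Rightarrow> 'v set \<Rightarrow> 'v set \<Rightarrow> bool" where
  "full a g X Y \<longleftrightarrow> (\<forall>X'\<subseteq>X. \<forall>Y'\<subseteq>Y. g \<le> real (card X') \<longrightarrow> g \<le> real (card Y') \<longrightarrow>
    (\<exists>x\<in>X'. \<exists>y\<in>Y'. a x y))"

lemma fullD:
  "full a g X Y \<Longrightarrow> X' \<subseteq> X \<Longrightarrow> Y' \<subseteq> Y \<Longrightarrow> g \<le> real (card X') \<Longrightarrow> g \<le> real (card Y') \<Longrightarrow>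
    \<exists>x\<in>X'. \<exists>y\<in>Y'. a x y"
  unfolding full_def by blast

lemma full_mono:
  assumes "full a g X Y" "X' \<subseteq> X" "Y' \<subseteq> Y" "g \<le> g'"
  shows "full a g' X' Y'"
  unfolding full_def using assms(2-4) by (intro allI impI fullD[OF assms(1)]) auto

lemma full_commute:
  assumes "full a g X Y" "\<And>x y. a x y \<Longrightarrow> a y x"
  shows "full a g Y X"
  unfolding full_def
proof (intro allI impI)
  fix Y' X' assume "Y' \<subseteq> Y" "X' \<subseteq> X" "g \<le> real (card Y')" "g \<le> real (card X')"
  then show "\<exists>y\<in>Y'. \<exists>x\<in>X'. a y x"
    using fullD[OF assms(1), of X' Y'] assms(2) by blast
qed

text \<open>Induction over colours: if colour \<open>i\<close> is not full at threshold
  \<open>\<xi> * s\<close>, the witnessing sets have no edge of colour \<open>i\<close>, so there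
  the remaining colours are jointly full at the same absolute threshold. Each elimination shrinks
  the scale by \<open>\<xi>\<close>.\<close>

lemma full_subpair:
  fixes s \<xi> :: real
  assumes "finite C" "0 < \<xi>" "\<xi> \<le> 1" "0 \<le> s"
    and "s \<le> card X" "s \<le> card Y"
    and "full (\<lambda>x y. \<exists>i\<in>C. a i x y) (\<xi> ^ card C * s) X Y"
  shows "\<exists>X'\<subseteq>X. \<exists>Y'\<subseteq>Y. \<exists>s'\<ge>\<xi> ^ card C * s. s' \<le> s \<and> s' \<le> card X' \<and> s' \<le> card Y' \<and>
    (\<exists>i\<in>C. full (a i) (\<xi> * s') X' Y')"
  using assms
proof (induction C arbitrary: X Y s rule: finite_induct)
  case empty
  then show ?case using fullD[OF empty(6), of X Y] by simp
next
  case (insert i C)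
  show ?case
  proof (cases "full (a i) (\<xi> * s) X Y")
    case True
    have "\<xi> ^ card (insert i C) * s \<le> s"
      using insert(4-6) by (intro mult_left_le_one_le power_le_one) auto
    then show ?thesis using True insert(7,8)
      by (intro exI[of _ X] exI[of _ Y] exI[of _ s] conjI bexI[of _ i]) auto
  next
    case False
    then obtain X1 Y1 where 1: "X1 \<subseteq> X" "Y1 \<subseteq> Y" "\<xi> * s \<le> card X1" "\<xi> * s \<le> card Y1"
      and no: "\<And>x y. x \<in> X1 \<Longrightarrow> y \<in> Y1 \<Longrightarrow> \<not> a i x y"
      unfolding full_def by blast
    have pow: "\<xi> ^ card C * (\<xi> * s) = \<xi> ^ card (insert i C) * s"
      using insert(1,2) by simp
    have "full (\<lambda>x y. \<exists>i\<in>C. a i x y) (\<xi> ^ card C * (\<xi> * s)) X1 Y1"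
      unfolding full_def
    proof (intro allI impI)
      fix X' Y' assume *: "X' \<subseteq> X1" "Y' \<subseteq> Y1" "\<xi> ^ card C * (\<xi> * s) \<le> card X'" "\<xi> ^ card C * (\<xi> * s) \<le> card Y'"
      then obtain x y j where "x \<in> X'" "y \<in> Y'" "j \<in> insert i C" "a j x y"
        using fullD[OF insert(9), of X' Y'] 1(1,2) unfolding pow by (meson order_trans)
      then show "\<exists>x\<in>X'. \<exists>y\<in>Y'. \<exists>i\<in>C. a i x y"
        using no *(1,2) by blast
    qed
    from insert.IH[OF insert(4,5) _ 1(3,4) this] insert(4,6)
    obtain X' Y' s' j where "X' \<subseteq> X1" "Y' \<subseteq> Y1" "\<xi> ^ card C * (\<xi> * s) \<le> s'" "s' \<le> \<xi> * s"
      "s' \<le> card X'" "s' \<le> card Y'" "j \<in> C" "full (a j) (\<xi> * s') X' Y'"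
      by auto
    moreover have "\<xi> * s \<le> s" using insert(4-6) by (simp add: mult_left_le_one_le)
    ultimately show ?thesis using 1(1,2) unfolding pow
      by (intro exI[of _ X'] exI[of _ Y'] exI[of _ s'] conjI bexI[of _ j]) auto
  qed
qed

text \<open>
  Fullness is stated at an absolute threshold, so it survives passing to subsets; pairs treated early
  need a threshold small compared with the sets that remain at the end.
\<close>

lemma full_subfamily:
  fixes ps :: "('t \<times> 't) list" and \<xi> :: real and k :: nat
  assumes "0 < \<xi>" "\<xi> \<le> 1" "set ps \<subseteq> I \<times> I - Id"
  shows "\<exists>\<epsilon>>0. \<epsilon> \<le> 1 \<and> (\<forall>s\<ge>0. \<forall>(B :: 't \<Rightarrow> 'v set) a. (\<forall>t\<in>I. s \<le> real (card (B t))) \<longrightarrow>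
    (\<forall>p\<in>I. \<forall>q\<in>I. p \<noteq> q \<longrightarrow> full (\<lambda>x y. \<exists>i<k. a i x y) (\<epsilon> * s) (B p) (B q)) \<longrightarrow>
    (\<exists>B' s'. (\<forall>t\<in>I. B' t \<subseteq> B t \<and> s' \<le> real (card (B' t))) \<and> \<epsilon> * s \<le> s' \<and>
      (\<forall>(p, q)\<in>set ps. \<exists>i<k. full (a i) (\<xi> * s') (B' p) (B' q))))"
  using assms(3)
proof (induction ps)
  case Nil
  show ?case
  proof (intro exI[of _ "1::real"] conjI allI impI)
    fix s :: real and B :: "'t \<Rightarrow> 'v set" and a :: "nat \<Rightarrow> 'v \<Rightarrow> 'v \<Rightarrow> bool"
    assume "\<forall>t\<in>I. s \<le> real (card (B t))"
    then show "\<exists>B' s'. (\<forall>t\<in>I. B' t \<subseteq> B t \<and> s' \<le> real (card (B' t))) \<and> 1 * s \<le> s' \<and>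
      (\<forall>(p, q)\<in>set []. \<exists>i<k. full (a i) (\<xi> * s') (B' p) (B' q))"
      by (intro exI[of _ B] exI[of _ s]) simp
  qed simp_all
next
  case (Cons pq ps)
  obtain p q where pq: "pq = (p, q)" "p \<noteq> q" "p \<in> I" "q \<in> I" using Cons.prems by (cases pq) auto
  have "set ps \<subseteq> I \<times> I - Id" using Cons.prems by simp
  from Cons.IH[OF this] obtain \<epsilon> where \<epsilon>: "0 < \<epsilon>" "\<epsilon> \<le> 1" and IH: "\<forall>s\<ge>0. \<forall>(B :: 't \<Rightarrow> 'v set) a.
    (\<forall>t\<in>I. s \<le> real (card (B t))) \<longrightarrow>
    (\<forall>p\<in>I. \<forall>q\<in>I. p \<noteq> q \<longrightarrow> full (\<lambda>x y. \<exists>i<k. a i x y) (\<epsilon> * s) (B p) (B q)) \<longrightarrow>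
    (\<exists>B' s'. (\<forall>t\<in>I. B' t \<subseteq> B t \<and> s' \<le> real (card (B' t))) \<and> \<epsilon> * s \<le> s' \<and>
      (\<forall>(p, q)\<in>set ps. \<exists>i<k. full (a i) (\<xi> * s') (B' p) (B' q)))"
    by (elim exE conjE) (rule that; assumption)
  \<comment> \<open>The sets may later shrink from scale \<open>s1\<close> to
    \<open>\<epsilon> * s1\<close>. The threshold \<open>\<zeta> * s1\<close> is then still at most
    \<open>\<xi> * s'\<close>.\<close>
  define \<zeta> where "\<zeta> = \<xi> * \<epsilon>"
  have \<zeta>: "0 < \<zeta>" "\<zeta> \<le> 1" using \<epsilon> assms(1,2) by (auto simp: \<zeta>_def mult_le_one)
  have \<zeta>k: "0 < \<zeta> ^ k" "\<zeta> ^ k \<le> 1" using \<zeta> by (simp_all add: power_le_one)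
  show ?case
  \<comment> \<open>The factor \<open>\<zeta> ^ k\<close> pays for eliminating colours at the first
    pair and \<open>\<epsilon>\<close> for all remaining pairs.\<close>
  proof (intro exI[of _ "\<epsilon> * \<zeta> ^ k"] conjI allI impI)
    show "0 < \<epsilon> * \<zeta> ^ k" "\<epsilon> * \<zeta> ^ k \<le> 1" using \<epsilon> \<zeta>k by (simp_all add: mult_le_one)
    fix s :: real and B :: "'t \<Rightarrow> 'v set" and a
    assume s: "0 \<le> s" and B: "\<forall>t\<in>I. s \<le> real (card (B t))"
      and ful: "\<forall>p\<in>I. \<forall>q\<in>I. p \<noteq> q \<longrightarrow> full (\<lambda>x y. \<exists>i<k. a i x y) (\<epsilon> * \<zeta> ^ k * s) (B p) (B q)"
    have le1: "\<epsilon> * \<zeta> ^ k * s \<le> \<zeta> ^ k * s"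
      using \<epsilon> \<zeta>k s by (simp add: mult_left_le_one_le mult.assoc)
    have "full (\<lambda>x y. \<exists>i\<in>{..<k}. a i x y) (\<zeta> ^ card {..<k} * s) (B p) (B q)"
    proof -
      have "full (\<lambda>x y. \<exists>i<k. a i x y) (\<epsilon> * \<zeta> ^ k * s) (B p) (B q)"
        using ful pq(2-4) by blast
      then have "full (\<lambda>x y. \<exists>i<k. a i x y) (\<zeta> ^ k * s) (B p) (B q)"
        by (rule full_mono[OF _ order_refl order_refl le1])
      then show ?thesis by (simp add: Bex_def)
    qed
    from full_subpair[OF _ \<zeta> s bspec[OF B pq(3)] bspec[OF B pq(4)] this]
    obtain X Y s1 where XY: "X \<subseteq> B p" "Y \<subseteq> B q" "\<zeta> ^ k * s \<le> s1" "s1 \<le> s" "s1 \<le> card X" "s1 \<le> card Y"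
      and i: "\<exists>i<k. full (a i) (\<zeta> * s1) X Y"
      by auto
    have s1: "0 \<le> s1" using XY(3) s \<zeta>k by (meson mult_nonneg_nonneg less_imp_le order_trans)
    define B1 where "B1 = B(p := X, q := Y)"
    have B1: "B1 t \<subseteq> B t" "s1 \<le> card (B1 t)" if "t \<in> I" for t
      using XY B pq(2) that by (auto simp: B1_def intro: order_trans)
    have le: "\<epsilon> * \<zeta> ^ k * s \<le> \<epsilon> * s1"
      using XY(3) \<epsilon> by (simp add: mult.assoc)
    have ful1: "\<forall>p\<in>I. \<forall>q\<in>I. p \<noteq> q \<longrightarrow> full (\<lambda>x y. \<exists>i<k. a i x y) (\<epsilon> * s1) (B1 p) (B1 q)"
      using ful by (intro ballI impI full_mono[OF _ B1(1) B1(1) le]) blast+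
    have B1': "\<forall>t\<in>I. s1 \<le> card (B1 t)" using B1(2) by blast
    obtain B' s' where B': "\<forall>t\<in>I. B' t \<subseteq> B1 t \<and> s' \<le> real (card (B' t))" "\<epsilon> * s1 \<le> s'"
      "\<forall>(p, q)\<in>set ps. \<exists>i<k. full (a i) (\<xi> * s') (B' p) (B' q)"
      using IH[THEN spec, THEN mp, OF s1, THEN spec, THEN spec, THEN mp, OF B1', THEN mp, OF ful1]
      by (elim exE conjE) (rule that; assumption)
    show "\<exists>B' s'. (\<forall>t\<in>I. B' t \<subseteq> B t \<and> s' \<le> real (card (B' t))) \<and> \<epsilon> * \<zeta> ^ k * s \<le> s' \<and>
      (\<forall>(p, q)\<in>set (pq # ps). \<exists>i<k. full (a i) (\<xi> * s') (B' p) (B' q))"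
    proof (intro exI[of _ B'] exI[of _ s'] conjI)
      show "\<forall>t\<in>I. B' t \<subseteq> B t \<and> s' \<le> real (card (B' t))"
        using B'(1) B1(1) by blast
      show "\<epsilon> * \<zeta> ^ k * s \<le> s'" using le B'(2) by linarith
      show "\<forall>(p, q)\<in>set (pq # ps). \<exists>i<k. full (a i) (\<xi> * s') (B' p) (B' q)"
      proof
        fix r assume r: "r \<in> set (pq # ps)"
        show "case r of (p, q) \<Rightarrow> \<exists>i<k. full (a i) (\<xi> * s') (B' p) (B' q)"
        proof (cases "r = pq")
          case True
          have "B' p \<subseteq> X" "B' q \<subseteq> Y" using bspec[OF B'(1) pq(3)] bspec[OF B'(1) pq(4)] pq(2) by (auto simp: B1_def)
          moreover have "\<zeta> * s1 \<le> \<xi> * s'"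
            using B'(2) assms(1) by (simp add: \<zeta>_def mult.assoc)
          ultimately show ?thesis using i True pq(1) by (auto intro: full_mono)
        next
          case False
          then show ?thesis using r B'(3) by auto
        qed
      qed
    qed
  qed
qed

text \<open>Consecutive intervals of an enumeration serve as parts. Rounding
  \<open>card V / N\<close> down costs less than a factor \<open>2\<close> because the quotient is
  at least \<open>1\<close>.\<close>

lemma equal_parts:
  fixes V :: "'v set"
  assumes "finite V" "0 < N" "N \<le> card V"
  shows "\<exists>B :: nat \<Rightarrow> 'v set. (\<forall>t<N. B t \<subseteq> V \<and> real (card V) / (2 * real N) \<le> real (card (B t))) \<and>
    (\<forall>t<N. \<forall>u<N. t \<noteq> u \<longrightarrow> B t \<inter> B u = {})"
proof -
  obtain h where h: "bij_betw h {0..<card V} V"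
    using ex_bij_betw_nat_finite[OF assms(1)] by blast
  define q where "q = card V div N"
  have q: "1 \<le> q" "card V < N * q + N" "N * q \<le> card V"
  proof -
    show "1 \<le> q" using assms by (simp add: q_def Suc_le_eq div_greater_zero_iff)
    have "card V mod N < N" using assms(2) by simp
    then show "card V < N * q + N" "N * q \<le> card V"
      using mult_div_mod_eq[of N "card V"] unfolding q_def by linarith+
  qed
  let ?I = "\<lambda>t. {t * q..<t * q + q}"
  have I: "?I t \<subseteq> {0..<card V}" if "t < N" for t
  proof -
    have "Suc t * q \<le> N * q" using that by (intro mult_right_mono) auto
    then have "t * q + q \<le> card V" using q(3) by simp
    then show ?thesis by auto
  qed
  have "card V < 2 * (N * q)"
  proof -
    have "N * 1 \<le> N * q" using q(1) by (intro mult_left_mono) auto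
    then show ?thesis using q(2) by linarith
  qed
  then have "real (card V) < real (2 * (N * q))" by (simp only: of_nat_less_iff)
  then have le: "real (card V) / (2 * real N) \<le> real q"
    using assms(2) by (simp add: field_simps)
  have inj: "inj_on h {0..<card V}" using h by (simp add: bij_betw_def)
  have "card (h ` ?I t) = q" if "t < N" for t
    using card_image[OF inj_on_subset[OF inj I[OF that]]] by simp
  moreover have "h ` ?I t \<subseteq> V" if "t < N" for t
    using h I[OF that] unfolding bij_betw_def by blast
  moreover have "h ` ?I t \<inter> h ` ?I u = {}" if "t < N" "u < N" "t \<noteq> u" for t u
  proof -
    have "x div q = t" if "x \<in> ?I t" for x t
      by (rule div_nat_eqI) (use that in \<open>auto simp: mult.commute\<close>)
    then have "?I t \<inter> ?I u = {}" using that(3) by blast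
    then show ?thesis
      using inj_on_image_Int[OF inj I[OF that(1)] I[OF that(2)]] by (metis image_is_empty)
  qed
  ultimately show ?thesis
    using le by (intro exI[of _ "\<lambda>t. h ` ?I t"]) simp
qed

lemma full_monochromatic_triple:
  fixes \<xi> :: real and k :: nat
  assumes \<xi>: "0 < \<xi>" "\<xi> \<le> 1"
  shows "\<exists>(\<epsilon> :: real) n0. 0 < \<epsilon> \<and> \<epsilon> \<le> 1 \<and> (\<forall>(V :: 'v set) a. finite V \<longrightarrow> n0 \<le> card V \<longrightarrow> (\<forall>i x y. a i x y \<longrightarrow> a i y x) \<longrightarrow>
    (\<forall>X Y. X \<subseteq> V \<longrightarrow> Y \<subseteq> V \<longrightarrow> X \<inter> Y = {} \<longrightarrow> \<epsilon> * real (card V) \<le> real (card X) \<longrightarrow> \<epsilon> * real (card V) \<le> real (card Y) \<longrightarrow>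
      (\<exists>x\<in>X. \<exists>y\<in>Y. \<exists>i<k. a i x y)) \<longrightarrow>
    (\<exists>i<k. \<exists>A (s :: real). \<epsilon> * real (card V) \<le> s \<and> (\<forall>c<3::nat. A c \<subseteq> V \<and> s \<le> real (card (A c))) \<and>
      (\<forall>b<3. \<forall>c<3. b \<noteq> c \<longrightarrow> A b \<inter> A c = {} \<and> full (a i) (\<xi> * s) (A b) (A c))))"
proof -
  \<comment> \<open>Ramsey's theorem for triangles in \<open>k\<close> colours; passing to
    \<open>Suc N0\<close> makes the number of parts positive.\<close>
  obtain N0 :: nat where N0: "partn_lst {..<N0} (replicate k 3) 2"
    using ramsey_full[of "replicate k 3" 2] by blast
  define N where "N = Suc N0"
  have N: "partn_lst {..<N} (replicate k 3) 2" "0 < N"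
    using partn_lst_greater_resource[OF N0] by (simp_all add: N_def)
  define ps where "ps = filter (\<lambda>(p, q). p \<noteq> q) (List.product [0..<N] [0..<N])"
  have ps: "set ps = {(p, q). p < N \<and> q < N \<and> p \<noteq> q}"
    by (auto simp: ps_def)
  have ps_pairs: "set ps \<subseteq> {..<N} \<times> {..<N} - Id"
    unfolding ps by auto
  note sub0 = full_subfamily[OF \<xi> ps_pairs, where k = k and 'v = 'v]
  obtain \<epsilon> where \<epsilon>: "0 < \<epsilon>" "\<epsilon> \<le> 1" and sub: "\<forall>s\<ge>0. \<forall>(B :: nat \<Rightarrow> 'v set) a.
    (\<forall>t\<in>{..<N}. s \<le> real (card (B t))) \<longrightarrow>
    (\<forall>p\<in>{..<N}. \<forall>q\<in>{..<N}. p \<noteq> q \<longrightarrow> full (\<lambda>x y. \<exists>i<k. a i x y) (\<epsilon> * s) (B p) (B q)) \<longrightarrow>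
    (\<exists>B' s'. (\<forall>t\<in>{..<N}. B' t \<subseteq> B t \<and> s' \<le> real (card (B' t))) \<and> \<epsilon> * s \<le> s' \<and>
      (\<forall>(p, q)\<in>set ps. \<exists>i<k. full (a i) (\<xi> * s') (B' p) (B' q)))"
    using sub0 by (elim exE conjE) (rule that; assumption)
  show ?thesis
  \<comment> \<open>Each part has at least \<open>card V / (2 * N)\<close> vertices, and the factor
    \<open>\<epsilon>\<close> is the loss in \<open>full_subfamily\<close>.\<close>
  proof (rule exI[of _ "\<epsilon> / (2 * real N)"], rule exI[of _ N], intro conjI allI impI)
    show "0 < \<epsilon> / (2 * real N)" using \<epsilon> N(2) by simp
    have "1 \<le> 2 * real N" using N(2) by linarith
    then show "\<epsilon> / (2 * real N) \<le> 1" using \<epsilon> by (simp add: divide_le_eq)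
    fix V :: "'v set" and a
    assume finV: "finite V" and NV: "N \<le> card V" and sym: "\<forall>i x y. a i x y \<longrightarrow> a i y x"
      and join: "\<forall>X Y. X \<subseteq> V \<longrightarrow> Y \<subseteq> V \<longrightarrow> X \<inter> Y = {} \<longrightarrow> \<epsilon> / (2 * real N) * real (card V) \<le> real (card X) \<longrightarrow>
        \<epsilon> / (2 * real N) * real (card V) \<le> real (card Y) \<longrightarrow> (\<exists>x\<in>X. \<exists>y\<in>Y. \<exists>i<k. a i x y)"
    define s where "s = real (card V) / (2 * real N)"
    obtain B :: "nat \<Rightarrow> 'v set" where B: "\<forall>t<N. B t \<subseteq> V \<and> s \<le> real (card (B t))"
      and Bdisj: "\<forall>t<N. \<forall>u<N. t \<noteq> u \<longrightarrow> B t \<inter> B u = {}"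
      using equal_parts[OF finV N(2) NV] unfolding s_def by blast
    have \<epsilon>s: "\<epsilon> * s = \<epsilon> / (2 * real N) * real (card V)" by (simp add: s_def)
    have ful: "full (\<lambda>x y. \<exists>i<k. a i x y) (\<epsilon> * s) (B p) (B q)" if pq: "p < N" "q < N" "p \<noteq> q" for p q
      unfolding full_def
    proof (intro allI impI)
      fix X Y assume XY: "X \<subseteq> B p" "Y \<subseteq> B q" "\<epsilon> * s \<le> real (card X)" "\<epsilon> * s \<le> real (card Y)"
      have "B p \<subseteq> V" "B q \<subseteq> V" "B p \<inter> B q = {}" using B Bdisj pq by simp_all
      then have "X \<subseteq> V" "Y \<subseteq> V" "X \<inter> Y = {}" using XY(1,2) by blast+
      then show "\<exists>x\<in>X. \<exists>y\<in>Y. \<exists>i<k. a i x y"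
        using join XY(3,4) unfolding \<epsilon>s by simp
    qed
    have s0: "0 \<le> s" by (simp add: s_def)
    have Bs: "\<forall>t\<in>{..<N}. s \<le> real (card (B t))" using B by blast
    have Bful: "\<forall>p\<in>{..<N}. \<forall>q\<in>{..<N}. p \<noteq> q \<longrightarrow> full (\<lambda>x y. \<exists>i<k. a i x y) (\<epsilon> * s) (B p) (B q)"
      using ful by blast
    obtain B' s' where B'_all: "\<forall>t\<in>{..<N}. B' t \<subseteq> B t \<and> s' \<le> real (card (B' t))" and s': "\<epsilon> * s \<le> s'"
      and pair: "\<forall>(p, q)\<in>set ps. \<exists>i<k. full (a i) (\<xi> * s') (B' p) (B' q)"
      using sub[THEN spec, THEN mp, OF s0, THEN spec, THEN spec, THEN mp, OF Bs, THEN mp, OF Bful]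
      by (elim exE conjE) (rule that; assumption)
    have B': "B' t \<subseteq> B t \<and> s' \<le> real (card (B' t))" if "t < N" for t
      using B'_all that by blast
    \<comment> \<open>A pair of parts is coloured by some colour in which it is full. Ordering by
      \<open>Min\<close> and \<open>Max\<close> picks one orientation, and symmetry of
      \<open>a\<close> supplies the other.\<close>
    define P where "P i e \<longleftrightarrow> i < k \<and> full (a i) (\<xi> * s') (B' (Min e)) (B' (Max e))" for i and e :: "nat set"
    define f where "f e = (SOME i. P i e)" for e
    have P: "P (f e) e" if e: "e \<in> nsets {..<N} 2" for e
    proof -
      obtain x y where "e = {x, y}" "x \<noteq> y" "x < N" "y < N"
        using e by (auto simp: nsets_def card_2_iff)
      then have "(Min e, Max e) \<in> set ps"
        unfolding ps by (auto simp: min_def max_def)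
      then have "\<exists>i. P i e" using pair by (auto simp: P_def)
      then show ?thesis unfolding f_def by (rule someI_ex)
    qed
    then have "f \<in> nsets {..<N} 2 \<rightarrow> {..<k}"
      by (auto simp: P_def)
    then obtain i H where i: "i < k" and H: "H \<in> nsets {..<N} 3" "f ` nsets H 2 \<subseteq> {i}"
      using N(1) unfolding partn_lst_def monochromatic_def by fastforce
    have H': "H \<subseteq> {..<N}" "finite H" "card H = 3" using H(1) by (auto simp: nsets_def)
    have mono: "full (a i) (\<xi> * s') (B' x) (B' y)" if xy: "x \<in> H" "y \<in> H" "x \<noteq> y" for x y
    proof -
      have "{x, y} \<in> nsets H 2" "{x, y} \<in> nsets {..<N} 2"
        using xy H'(1) by (auto simp: nsets_def)
      then have "P (f {x, y}) {x, y}" "f {x, y} = i" using P H(2) by blast+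
      then have "P i {x, y}" by simp
      then have "full (a i) (\<xi> * s') (B' (min x y)) (B' (max x y))"
        by (simp add: P_def)
      moreover from this have "full (a i) (\<xi> * s') (B' (max x y)) (B' (min x y))"
        by (rule full_commute) (use sym in blast)
      ultimately show ?thesis
        by (cases "x \<le> y") (simp_all add: min_def max_def)
    qed
    obtain h where h: "bij_betw h {0..<3::nat} H"
      using ex_bij_betw_nat_finite[OF H'(2)] H'(3) by auto
    have hH: "h c \<in> H" "h c < N" if "c < 3" for c
    proof -
      show "h c \<in> H" using h that unfolding bij_betw_def by auto
      then show "h c < N" using H'(1) by blast
    qed
    have hne: "h b \<noteq> h c" if "b < 3" "c < 3" "b \<noteq> c" for b c
      using h that unfolding bij_betw_def inj_on_def by auto
    have 1: "B' (h c) \<subseteq> V \<and> s' \<le> card (B' (h c))" if "c < 3" for c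
      using B'[OF hH(2)[OF that]] B hH(2)[OF that] by blast
    have 2: "B' (h b) \<inter> B' (h c) = {} \<and> full (a i) (\<xi> * s') (B' (h b)) (B' (h c))"
      if "b < 3" "c < 3" "b \<noteq> c" for b c
    proof
      show "full (a i) (\<xi> * s') (B' (h b)) (B' (h c))"
        using mono hH(1) hne that by simp
      have "B (h b) \<inter> B (h c) = {}"
        using Bdisj hH(2) hne that by simp
      then show "B' (h b) \<inter> B' (h c) = {}"
        using B'[OF hH(2)[OF that(1)]] B'[OF hH(2)[OF that(2)]] by blast
    qed
    show "\<exists>i<k. \<exists>A (s :: real). \<epsilon> / (2 * real N) * real (card V) \<le> s \<and> (\<forall>c<3::nat. A c \<subseteq> V \<and> s \<le> real (card (A c))) \<and>
      (\<forall>b<3. \<forall>c<3. b \<noteq> c \<longrightarrow> A b \<inter> A c = {} \<and> full (a i) (\<xi> * s) (A b) (A c))"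
      using i s' 1 2 unfolding \<epsilon>s
      by (intro exI[of _ i] conjI exI[of _ "\<lambda>c. B' (h c)"] exI[of _ s']) auto
  qed
qed

section \<open>Monochromatic subdivisions in uniform graphs\<close>

text \<open>Because \<open>\<eta>\<close> is below \<open>1\<close>, the permitted deviation is
  strictly smaller than the expected number of edges.\<close>

lemma edges_between_pos:
  assumes G: "uniform_graph \<eta> G" "\<eta> < 1" and p: "0 < edge_density G"
    and X: "X \<subseteq> verts G" "Y \<subseteq> verts G" "X \<inter> Y = {}"
    and size: "\<eta> * real (nv G) \<le> real (card X)" "\<eta> * real (nv G) \<le> real (card Y)"
    and pos: "0 < card X" "0 < card Y"
  shows "\<exists>x\<in>X. \<exists>y\<in>Y. {x, y} \<in> edges G"
proof -
  define t where "t = real (card X) * real (card Y) * edge_density G"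
  have "0 < t" using p pos by (simp add: t_def)
  have "\<bar>real (edges_between G X Y) - t\<bar> \<le> \<eta> * real (card X) * real (card Y) * edge_density G"
    using G(1) X size unfolding uniform_graph_def t_def by blast
  also have "\<dots> = \<eta> * t" by (simp add: t_def)
  also have "\<dots> < t" using G(2) \<open>0 < t\<close> by simp
  finally have "0 < edges_between G X Y" by linarith
  then have "{e \<in> edges G. \<exists>u\<in>X. \<exists>w\<in>Y. e = {u, w}} \<noteq> {}"
    unfolding edges_between_def by (metis card.empty less_irrefl)
  then show ?thesis by blast
qed

text \<open>Chooses the tree depth: enough leaves, at most \<open>d\<close> times too many, and the
  last alternative makes the depth logarithmic in \<open>m\<close>.\<close>

lemma exists_least_power:
  fixes d m :: nat
  assumes "2 \<le> d" "1 \<le> m"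
  shows "\<exists>h. m \<le> d ^ h \<and> d ^ h \<le> d * m \<and> (h = 0 \<or> d ^ (h - 1) < m)"
proof -
  have "m \<le> d ^ m"
    using assms(1) by (metis less_imp_le less_exp order_trans power_mono zero_le)
  then obtain h where h: "m \<le> d ^ h" "\<And>j. j < h \<Longrightarrow> \<not> m \<le> d ^ j"
    using exists_least_iff[of "\<lambda>h. m \<le> d ^ h"] by blast
  show ?thesis
  proof (cases h)
    case 0
    then show ?thesis using h(1) assms by (intro exI[of _ 0]) auto
  next
    case (Suc g)
    then have "d ^ g < m" using h(2)[of g] by simp
    then have "d ^ h \<le> d * m" using Suc by simp
    then show ?thesis using h(1) Suc \<open>d ^ g < m\<close> by (intro exI[of _ h]) simp
  qed
qed

theorem theorem1p4:
  fixes k D :: nat and \<delta> :: real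
  assumes "\<delta> > 0"
  shows "\<exists>\<eta> \<alpha> C :: real. 0 < \<eta> \<and> \<eta> \<le> 1 \<and> 0 < \<alpha> \<and> 0 < C \<and>
    (\<forall>G :: nat ugraph. finite_graph G \<longrightarrow> uniform_graph \<eta> G \<longrightarrow> real (ne G) \<ge> C * real (nv G) \<longrightarrow>
      (\<forall>c. edge_coloring k G c \<longrightarrow>
        (\<forall>(H :: nat ugraph) \<sigma>. finite_graph H \<longrightarrow> max_degree_le H D \<longrightarrow>
           (\<forall>e\<in>edges H. \<sigma> e \<ge> 1 \<and> real (\<sigma> e) \<ge> \<delta> * ln (real (nv G))) \<longrightarrow>
           real (nv (subdivision H \<sigma>)) \<le> \<alpha> * real (nv G) \<longrightarrow>
           has_monochromatic_copy G c (subdivision H \<sigma>))))"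
proof -
  \<comment> \<open>\<open>D\<close> provides a slot index for every edge at a branch vertex; the
    exponential makes \<open>ln n / ln d\<close>, which governs the tree depth, at most
    \<open>\<delta> / 4 * ln n\<close>, so two trees use about half of the guaranteed path
    length.\<close>
  define d where "d = max 2 (max D (nat \<lceil>exp (4 / \<delta>)\<rceil>))"
  have d: "2 \<le> d" "D \<le> d" by (auto simp: d_def)
  have "exp (4 / \<delta>) \<le> real (nat \<lceil>exp (4 / \<delta>)\<rceil>)"
    by (rule real_nat_ceiling_ge)
  also have "nat \<lceil>exp (4 / \<delta>)\<rceil> \<le> d"
    unfolding d_def by linarith
  finally have ln_d: "4 / \<delta> \<le> ln (real d)"
    using d(1) by (subst ln_ge_iff) auto
  \<comment> \<open>Chosen so that \<open>50 * (d * m0)\<close> is at most \<open>s\<close> although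
    rounding up to \<open>m0\<close> may double \<open>\<xi> * s\<close>.\<close>
  define \<xi> where "\<xi> = 1 / (100 * real d)"
  have \<xi>: "0 < \<xi>" "\<xi> \<le> 1" using d(1) by (simp_all add: \<xi>_def)
  obtain \<epsilon> n0 where \<epsilon>: "0 < \<epsilon>" "\<epsilon> \<le> 1"
    and triple: "\<forall>(V :: nat set) a. finite V \<longrightarrow> n0 \<le> card V \<longrightarrow> (\<forall>i x y. a i x y \<longrightarrow> a i y x) \<longrightarrow>
    (\<forall>X Y. X \<subseteq> V \<longrightarrow> Y \<subseteq> V \<longrightarrow> X \<inter> Y = {} \<longrightarrow> \<epsilon> * real (card V) \<le> real (card X) \<longrightarrow> \<epsilon> * real (card V) \<le> real (card Y) \<longrightarrow>
      (\<exists>x\<in>X. \<exists>y\<in>Y. \<exists>i<k. a i x y)) \<longrightarrow>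
    (\<exists>i<k. \<exists>A (s :: real). \<epsilon> * real (card V) \<le> s \<and> (\<forall>c<3::nat. A c \<subseteq> V \<and> s \<le> real (card (A c))) \<and>
      (\<forall>b<3. \<forall>c<3. b \<noteq> c \<longrightarrow> A b \<inter> A c = {} \<and> full (a i) (\<xi> * s) (A b) (A c)))"
    using full_monochromatic_triple[OF \<xi>, where k = k and 'v = nat] by (elim exE conjE) (rule that; assumption)
  \<comment> \<open>The first bound yields \<open>nv (subdivision H \<sigma>) \<le> m0\<close>. Once
    \<open>\<alpha> * n\<close> is at least \<open>1\<close>, the other two give
    \<open>n \<ge> n0 + 2\<close> and \<open>\<delta> * ln n \<ge> 10\<close>.\<close>
  define \<alpha> where "\<alpha> = min (\<xi> * \<epsilon>) (min (1 / real (n0 + 2)) (exp (- (10 / \<delta>))))"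
  have \<alpha>: "0 < \<alpha>" "\<alpha> \<le> \<xi> * \<epsilon>" "\<alpha> \<le> 1 / real (n0 + 2)" "\<alpha> \<le> exp (- (10 / \<delta>))"
    using \<xi> \<epsilon> by (auto simp: \<alpha>_def)
  have copy: "has_monochromatic_copy G c (subdivision H \<sigma>)"
    if G: "finite_graph G" "uniform_graph (\<epsilon> / 2) G" "real (ne G) \<ge> 1 * real (nv G)"
      and c: "edge_coloring k G c" and H: "finite_graph H" "max_degree_le H D"
      and \<sigma>: "\<forall>e\<in>edges H. \<sigma> e \<ge> 1 \<and> real (\<sigma> e) \<ge> \<delta> * ln (real (nv G))"
      and small: "real (nv (subdivision H \<sigma>)) \<le> \<alpha> * real (nv G)"
    for G H :: "nat ugraph" and c \<sigma>
  proof (cases "\<alpha> * real (nv G) < 1")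
    \<comment> \<open>The subdivision then has no vertices at all, which disposes of small
      graphs.\<close>
    case True
    have fin: "finite_graph (subdivision H \<sigma>)"
      using finite_graph_subdivision(1)[OF H(1)] \<sigma> by blast
    have "nv (subdivision H \<sigma>) = 0" using small True by linarith
    then have "verts (subdivision H \<sigma>) = {}"
      using fin unfolding nv_def finite_graph_def by simp
    moreover from this have "edges (subdivision H \<sigma>) = {}"
      using fin unfolding finite_graph_def by fastforce
    ultimately show ?thesis unfolding has_monochromatic_copy_def by simp
  next
    case False
    define n where "n = real (nv G)"
    have n: "1 \<le> \<alpha> * n" using False by (simp add: n_def)
    have n_nonneg: "0 \<le> n" by (simp add: n_def)
    have "1 \<le> 1 / real (n0 + 2) * n"
      using n mult_right_mono[OF \<alpha>(3) n_nonneg] by linarith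
    then have n2: "real (n0 + 2) \<le> n" by (simp add: field_simps)
    have "1 \<le> exp (- (10 / \<delta>)) * n"
      using n mult_right_mono[OF \<alpha>(4) n_nonneg] by linarith
    then have "exp (10 / \<delta>) \<le> n" by (simp add: exp_minus field_simps)
    then have "10 / \<delta> \<le> ln n"
      using n2 by (subst ln_ge_iff) auto
    then have ln_n: "10 \<le> \<delta> * ln n"
      using assms by (simp add: field_simps)
    have finV: "finite (verts G)" and nG: "n = real (card (verts G))"
      using G(1) by (simp_all add: finite_graph_def n_def nv_def)
    have "0 < nv G choose 2" using n2 by (simp add: n_def zero_less_binomial_iff)
    moreover have "0 < real (ne G)" using G(3) n2 by (simp add: n_def)
    ultimately have p: "0 < edge_density G" by (simp add: edge_density_def)
    define a where "a i x y \<longleftrightarrow> {x, y} \<in> edges G \<and> c {x, y} = i" for i x y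
    have a_sym: "\<forall>i x y. a i x y \<longrightarrow> a i y x" by (simp add: a_def insert_commute)
    have join: "\<forall>X Y. X \<subseteq> verts G \<longrightarrow> Y \<subseteq> verts G \<longrightarrow> X \<inter> Y = {} \<longrightarrow>
      \<epsilon> * real (card (verts G)) \<le> real (card X) \<longrightarrow> \<epsilon> * real (card (verts G)) \<le> real (card Y) \<longrightarrow>
      (\<exists>x\<in>X. \<exists>y\<in>Y. \<exists>i<k. a i x y)"
    proof (intro allI impI)
      fix X Y assume XY: "X \<subseteq> verts G" "Y \<subseteq> verts G" "X \<inter> Y = {}"
        "\<epsilon> * real (card (verts G)) \<le> real (card X)" "\<epsilon> * real (card (verts G)) \<le> real (card Y)"
      have en: "0 < \<epsilon> * n" using \<epsilon> n2 by simp
      have "\<exists>x\<in>X. \<exists>y\<in>Y. {x, y} \<in> edges G"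
      proof (rule edges_between_pos[OF G(2) _ p XY(1-3)])
        show "\<epsilon> / 2 < 1" using \<epsilon> by simp
        show "\<epsilon> / 2 * real (nv G) \<le> real (card X)" "\<epsilon> / 2 * real (nv G) \<le> real (card Y)"
          using XY(4,5) en unfolding nG[symmetric] n_def by simp_all
        show "0 < card X" "0 < card Y"
          using XY(4,5) en unfolding nG[symmetric] by linarith+
      qed
      then show "\<exists>x\<in>X. \<exists>y\<in>Y. \<exists>i<k. a i x y"
        using c unfolding edge_coloring_def a_def by blast
    qed
    have "n0 \<le> card (verts G)" using n2 unfolding nG by linarith
    from triple[THEN spec, THEN spec, THEN mp, OF finV, THEN mp, OF this, THEN mp, OF a_sym, THEN mp, OF join]
    obtain i A s where i: "i < k" and s: "\<epsilon> * n \<le> s"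
      and A: "\<forall>c<3::nat. A c \<subseteq> verts G \<and> s \<le> real (card (A c))"
      and pair: "\<forall>b<3. \<forall>c<3. b \<noteq> c \<longrightarrow> A b \<inter> A c = {} \<and> full (a i) (\<xi> * s) (A b) (A c)"
      unfolding nG[symmetric] by (elim exE conjE) (rule that; assumption)
    define m0 where "m0 = nat \<lceil>\<xi> * s\<rceil>"
    have "\<xi> * (\<epsilon> * n) \<le> \<xi> * s" using s \<xi> by simp
    moreover have "\<alpha> * n \<le> \<xi> * \<epsilon> * n" using \<alpha>(2) n_nonneg by (rule mult_right_mono)
    ultimately have \<alpha>s: "\<alpha> * n \<le> \<xi> * s" by simp
    then have \<xi>s: "1 \<le> \<xi> * s" using n by linarith
    have m0: "\<xi> * s \<le> real m0" "real m0 \<le> 2 * (\<xi> * s)"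
      using \<xi>s unfolding m0_def by linarith+
    then have m0_pos: "1 \<le> m0" using \<xi>s by linarith
    have large: "50 * (d * m0) \<le> card (A c)" if "c < 3" for c
    proof -
      have "real (50 * (d * m0)) = 50 * real d * real m0" by simp
      also have "\<dots> \<le> 50 * real d * (2 * (\<xi> * s))"
        using m0(2) by (intro mult_left_mono) auto
      also have "\<dots> = s" using d(1) by (simp add: \<xi>_def)
      also have "\<dots> \<le> real (card (A c))" using A that by blast
      finally show ?thesis by (simp only: of_nat_le_iff)
    qed
    have host: "host A (a i) m0 d (verts H)"
    proof
      show "finite (A c)" if "c < 3" for c
        using A finV that by (meson finite_subset)
      show "A b \<inter> A c = {}" if "b < 3" "c < 3" "b \<noteq> c" for b c
        using pair that by blast
      show "a i x y \<Longrightarrow> a i y x" for x y using a_sym by blast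
      show "\<exists>x\<in>X. \<exists>y\<in>Y. a i x y"
        if "b < 3" "c < 3" "b \<noteq> c" "X \<subseteq> A b" "Y \<subseteq> A c" "m0 \<le> card X" "m0 \<le> card Y" for b c X Y
      proof -
        have "full (a i) (\<xi> * s) (A b) (A c)" using pair that by blast
        moreover have "\<xi> * s \<le> real (card X)" "\<xi> * s \<le> real (card Y)"
          using m0(1) that(6,7) by linarith+
        ultimately show ?thesis using fullD that(4,5) by blast
      qed
      show "finite (verts H)" using H(1) by (simp add: finite_graph_def)
    qed (use large m0_pos d in auto)
    obtain h where h: "m0 \<le> d ^ h" "d ^ h \<le> d * m0" "h = 0 \<or> d ^ (h - 1) < m0"
      using exists_least_power[OF d(1) m0_pos] by blast
    have "m0 \<le> d * m0" using d(1) by simp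
    then have "m0 \<le> card (A 0)" using large[of 0] by linarith
    also have "\<dots> \<le> card (verts G)" using A finV by (intro card_mono) auto
    finally have m0_n: "real m0 \<le> n" unfolding nG by simp
    \<comment> \<open>By minimality \<open>d ^ (h - 1) < m0 \<le> n\<close> unless
      \<open>h = 0\<close>, where truncated subtraction makes the left side
      \<open>0\<close>.\<close>
    have h_le: "2 * real (h - 1) \<le> \<delta> * ln n / 2"
    proof (cases "h = 0")
      case True
      then show ?thesis using ln_n by simp
    next
      case False
      then have "real (d ^ (h - 1)) \<le> n" using h(3) m0_n by linarith
      then have "ln (real d ^ (h - 1)) \<le> ln n"
        using d(1) n2 by (subst ln_le_cancel_iff) auto
      then have "real (h - 1) * ln (real d) \<le> ln n"
        using d(1) by (simp add: ln_realpow)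
      moreover have "real (h - 1) * (4 / \<delta>) \<le> real (h - 1) * ln (real d)"
        using ln_d by (intro mult_left_mono) auto
      ultimately have "real (h - 1) * (4 / \<delta>) \<le> ln n" by linarith
      then show ?thesis using assms by (simp add: field_simps)
    qed
    have long: "2 * h + 3 \<le> \<sigma> e" if "e \<in> edges H" for e
    proof -
      \<comment> \<open>Half of \<open>\<delta> * ln n\<close> pays for the trees and the other
        half, at least \<open>5\<close>, for the constant.\<close>
      have "real (2 * h + 3) \<le> 2 * real (h - 1) + 5" by linarith
      also have "\<dots> \<le> \<delta> * ln n" using h_le ln_n by linarith
      also have "\<dots> \<le> real (\<sigma> e)" using \<sigma> that unfolding n_def by blast
      finally show ?thesis by (simp only: of_nat_le_iff)
    qed
    have degH: "max_degree_le H d"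
      using H(2) d(2) unfolding max_degree_le_def by (meson order_trans)
    have smallH: "nv (subdivision H \<sigma>) \<le> m0"
      using small \<alpha>s m0(1) unfolding n_def by linarith
    obtain f where f: "inj_on f (verts (subdivision H \<sigma>))" "f ` verts (subdivision H \<sigma>) \<subseteq> (\<Union>c<3. A c)"
      "\<forall>e\<in>edges (subdivision H \<sigma>). \<exists>x y. f ` e = {x, y} \<and> a i x y"
      using embed_subdivision[OF host H(1) degH long smallH h(1,2)] by blast
    have f_verts: "f ` verts (subdivision H \<sigma>) \<subseteq> verts G" using f(2) A by blast
    have f_edges: "f ` e \<in> edges G \<and> c (f ` e) = i" if "e \<in> edges (subdivision H \<sigma>)" for e
      using f(3) that unfolding a_def by metis
    show ?thesis
      unfolding has_monochromatic_copy_def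
      by (rule exI[of _ f], rule exI[of _ i]) (intro conjI ballI f(1) f_verts; simp add: f_edges)
  qed
  show ?thesis
  \<comment> \<open>Halving \<open>\<epsilon>\<close> makes the uniformity parameter strictly
    smaller than \<open>1\<close>; the edge bound with constant \<open>1\<close> ensures positive
    density.\<close>
  proof (rule exI[of _ "\<epsilon> / 2"], rule exI[of _ \<alpha>], rule exI[of _ 1], intro conjI allI impI)
    show "0 < \<epsilon> / 2" "\<epsilon> / 2 \<le> 1" "0 < \<alpha>" "0 < (1 :: real)"
      using \<epsilon> \<alpha>(1) by simp_all
  qed (rule copy; assumption)
qed

end
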